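(* Let $(A,\mu,\tilde\eta,B_A,\beta_A)$, $\tilde\eta=(\eta_1,\dots,\eta_{n-1})$, be a Hom-quadratic symmetric $n$-ary totally Hom-associative algebra, and let $(\mathcal{N},[\cdot,\dots,\cdot]_\mathcal{N},\tilde\alpha,B_\mathcal{N},\beta_\mathcal{N})$, $\tilde\alpha=(\alpha_1,\dots,\alpha_{n-1})$, be a Hom-quadratic $n$-ary Hom-Nambu algebra. On $A\otimes\mathcal{N}$ consider the $n$-linear bracket $[a_1\otimes x_1,\dots,a_n\otimes x_n]=\mu(a_1,\dots,a_n)\otimes[x_1,\dots,x_n]_\mathcal{N}$, the maps $\tilde\zeta=(\zeta_1,\dots,\zeta_{n-1})$ with $\zeta_i=\eta_i\otimes\alpha_i$, and $$\widetilde{B}(a\otimes x,b\otimes y)=B_A(a,b)B_\mathcal{N}(x,y),\qquad \omega(a\otimes x)=\beta_A(a)\otimes\beta_\mathcal{N}(x)$$ (all extended (multi)linearly). Then $(A\otimes\mathcal{N},[\cdot,\dots,\cdot],\tilde\zeta,\widetilde{B},\omega)$ is a Hom-quadratic $n$-ary Hom-Nambu algebra.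
   Context: $\mathbb{K}$ is an algebraically closed field of characteristic zero and $n\ge 2$. An $n$-ary Hom-Nambu algebra is a triple $(\mathcal{N},[\cdot,\dots,\cdot],\tilde\alpha)$ with $\mathcal{N}$ a $\mathbb{K}$-vector space, $[\cdot,\dots,\cdot]:\mathcal{N}^n\to\mathcal{N}$ an $n$-linear map and $\tilde\alpha=(\alpha_1,\dots,\alpha_{n-1})$ linear maps $\mathcal{N}\to\mathcal{N}$ such that $$[\alpha_1(x_1),\dots,\alpha_{n-1}(x_{n-1}),[y_1,\dots,y_n]]=\sum_{i=1}^n[\alpha_1(y_1),\dots,\alpha_{i-1}(y_{i-1}),[x_1,\dots,x_{n-1},y_i],\alpha_i(y_{i+1}),\dots,\alpha_{n-1}(y_n)].$$ $(\mathcal{N},[\cdot,\dots,\cdot],\tilde\alpha,B,\beta)$ is a Hom-quadratic $n$-ary Hom-Nambu algebra if $B$ is a nondegenerate symmetric bilinear form and $\beta\in End(\mathcal{N})$ satisfies $B([x_1,\dots,x_{n-1},y],\beta(z))+B(\beta(y),[x_1,\dots,x_{n-1},z])=0$ for all elements. A symmetric $n$-ary totally Hom-associative algebra $(A,\mu,\tilde\eta)$ is a $\mathbb{K}$-vector space $A$ with an $n$-linear map $\mu:A^n\to A$ invariant under all permutations of its arguments and linear maps $\eta_1,\dots,\eta_{n-1}:A\to A$ such that for all $a_1,\dots,a_{2n-1}\in A$ the element $$\mu\big(\eta_1(a_1),\dots,\eta_{i-1}(a_{i-1}),\mu(a_i,\dots,a_{i+n-1}),\eta_i(a_{i+n}),\dots,\eta_{n-1}(a_{2n-1})\big)$$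 is the same for all $i\in\{1,\dots,n\}$. It is Hom-quadratic, written $(A,\mu,\tilde\eta,B_A,\beta_A)$, if $B_A$ is a nondegenerate symmetric bilinear form on $A$ and $\beta_A\in End(A)$ is a linear map with $B_A(\eta_i(a),b)=B_A(a,\eta_i(b))$ for all $i$ and $B_A(\mu(a_1,\dots,a_{n-1},b),\beta_A(c))=B_A(\beta_A(b),\mu(a_1,\dots,a_{n-1},c))$ for all $a_j,a,b,c\in A$. *)

theory Defs
  imports
    "HOL-Algebra.Algebraic_Closure"
    "HOL-Combinatorics.Permutations"
    "Jordan_Normal_Form.Missing_VectorSpace"
begin

text \<open>
  Vector spaces are the locale \<open>vectorspace\<close> of the AFP entry VectorSpace, that is, modules in the
  sense of HOL-Algebra over a field. An \<open>n\<close>-ary operation takes a list of length \<open>n\<close>. All indices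
  start at \<open>0\<close>, so the twisting maps \<open>\<alpha>\<^sub>1, \<dots>, \<alpha>\<^sub>n\<^sub>-\<^sub>1\<close> of the literature are
  \<open>\<alpha> 0, \<dots>, \<alpha> (n - 2)\<close> here. No condition is imposed on operations outside the carriers, on lists
  of the wrong length, or on \<open>\<alpha> i\<close> for \<open>i \<ge> n - 1\<close>.
\<close>

definition char_zero :: "('k, 'm) ring_scheme \<Rightarrow> bool" where
  "char_zero K \<longleftrightarrow> (\<forall>m::nat. 0 < m \<longrightarrow> [m] \<cdot>\<^bsub>K\<^esub> \<one>\<^bsub>K\<^esub> \<noteq> \<zero>\<^bsub>K\<^esub>)"


section \<open>Multilinear maps and bilinear forms\<close>

definition tuples :: "nat \<Rightarrow> ('v, 'm) partial_object_scheme \<Rightarrow> 'v list set" where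
  "tuples n V = {xs. length xs = n \<and> set xs \<subseteq> carrier V}"

definition multilinear_map ::
  "('k, 'm) ring_scheme \<Rightarrow> nat \<Rightarrow> ('k, 'v, 'p) module_scheme \<Rightarrow> ('k, 'w, 'q) module_scheme
    \<Rightarrow> ('v list \<Rightarrow> 'w) \<Rightarrow> bool" where
  "multilinear_map K n V W f \<longleftrightarrow>
     (\<forall>xs \<in> tuples n V. f xs \<in> carrier W) \<and>
     (\<forall>xs \<in> tuples n V. \<forall>i < n. \<forall>u \<in> carrier V. \<forall>v \<in> carrier V.
        f (xs[i := u \<oplus>\<^bsub>V\<^esub> v]) = f (xs[i := u]) \<oplus>\<^bsub>W\<^esub> f (xs[i := v])) \<and>
     (\<forall>xs \<in> tuples n V. \<forall>i < n. \<forall>c \<in> carrier K. \<forall>v \<in> carrier V.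
        f (xs[i := c \<odot>\<^bsub>V\<^esub> v]) = c \<odot>\<^bsub>W\<^esub> f (xs[i := v]))"

definition bilinear_form ::
  "('k, 'm) ring_scheme \<Rightarrow> ('k, 'v, 'p) module_scheme \<Rightarrow> ('v \<Rightarrow> 'v \<Rightarrow> 'k) \<Rightarrow> bool" where
  "bilinear_form K V B \<longleftrightarrow>
     (\<forall>x \<in> carrier V. \<forall>y \<in> carrier V. B x y \<in> carrier K) \<and>
     (\<forall>x \<in> carrier V. \<forall>y \<in> carrier V. \<forall>z \<in> carrier V.
        B (x \<oplus>\<^bsub>V\<^esub> y) z = B x z \<oplus>\<^bsub>K\<^esub> B y z \<and>
        B x (y \<oplus>\<^bsub>V\<^esub> z) = B x y \<oplus>\<^bsub>K\<^esub> B x z) \<and>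
     (\<forall>c \<in> carrier K. \<forall>x \<in> carrier V. \<forall>y \<in> carrier V.
        B (c \<odot>\<^bsub>V\<^esub> x) y = c \<otimes>\<^bsub>K\<^esub> B x y \<and>
        B x (c \<odot>\<^bsub>V\<^esub> y) = c \<otimes>\<^bsub>K\<^esub> B x y)"

definition symmetric_form ::
  "('k, 'v, 'p) module_scheme \<Rightarrow> ('v \<Rightarrow> 'v \<Rightarrow> 'k) \<Rightarrow> bool" where
  "symmetric_form V B \<longleftrightarrow> (\<forall>x \<in> carrier V. \<forall>y \<in> carrier V. B x y = B y x)"

text \<open>For a symmetric form the left radical is also the right one.\<close>

definition nondegenerate_form ::
  "('k, 'm) ring_scheme \<Rightarrow> ('k, 'v, 'p) module_scheme \<Rightarrow> ('v \<Rightarrow> 'v \<Rightarrow> 'k) \<Rightarrow> bool" where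
  "nondegenerate_form K V B \<longleftrightarrow>
     (\<forall>x \<in> carrier V. (\<forall>y \<in> carrier V. B x y = \<zero>\<^bsub>K\<^esub>) \<longrightarrow> x = \<zero>\<^bsub>V\<^esub>)"


section \<open>Hom-Nambu algebras\<close>

text \<open>
  In the \<open>i\<close>-th summand of the identity below, the slots before the inner bracket carry
  \<open>\<alpha> j (y\<^sub>j)\<close>, while those after it carry \<open>\<alpha> (j - 1) (y\<^sub>j)\<close>.
\<close>

definition hom_nambu_algebra ::
  "('k, 'm) ring_scheme \<Rightarrow> nat \<Rightarrow> ('k, 'v, 'p) module_scheme \<Rightarrow> ('v list \<Rightarrow> 'v)
    \<Rightarrow> (nat \<Rightarrow> 'v \<Rightarrow> 'v) \<Rightarrow> bool" where
  "hom_nambu_algebra K n N br \<alpha> \<longleftrightarrow>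
     vectorspace K N \<and>
     multilinear_map K n N N br \<and>
     (\<forall>i < n - 1. linear_map K N N (\<alpha> i)) \<and>
     (\<forall>xs \<in> tuples (n - 1) N. \<forall>ys \<in> tuples n N.
        br (map (\<lambda>j. \<alpha> j (xs ! j)) [0..<n - 1] @ [br ys]) =
        (\<Oplus>\<^bsub>N\<^esub> i \<in> {..<n}.
           br (map (\<lambda>j. if j < i then \<alpha> j (ys ! j)
                        else if j = i then br (xs @ [ys ! i])
                        else \<alpha> (j - 1) (ys ! j)) [0..<n])))"

definition hom_quadratic_hom_nambu_algebra ::
  "('k, 'm) ring_scheme \<Rightarrow> nat \<Rightarrow> ('k, 'v, 'p) module_scheme \<Rightarrow> ('v list \<Rightarrow> 'v)
    \<Rightarrow> (nat \<Rightarrow> 'v \<Rightarrow> 'v) \<Rightarrow> ('v \<Rightarrow> 'v \<Rightarrow> 'k) \<Rightarrow> ('v \<Rightarrow> 'v) \<Rightarrow> bool" where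
  "hom_quadratic_hom_nambu_algebra K n N br \<alpha> B \<beta> \<longleftrightarrow>
     hom_nambu_algebra K n N br \<alpha> \<and>
     bilinear_form K N B \<and> symmetric_form N B \<and> nondegenerate_form K N B \<and>
     linear_map K N N \<beta> \<and>
     (\<forall>xs \<in> tuples (n - 1) N. \<forall>y \<in> carrier N. \<forall>z \<in> carrier N.
        B (br (xs @ [y])) (\<beta> z) \<oplus>\<^bsub>K\<^esub> B (\<beta> y) (br (xs @ [z])) = \<zero>\<^bsub>K\<^esub>)"


section \<open>Symmetric totally Hom-associative algebras\<close>

text \<open>
  The product of \<open>2n - 1\<close> elements with the inner product starting at position \<open>i\<close>;
  \<open>take n (drop i as)\<close> is the block \<open>a\<^sub>i, \<dots>, a\<^sub>i\<^sub>+\<^sub>n\<^sub>-\<^sub>1\<close>.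
\<close>

definition hom_assoc_product ::
  "nat \<Rightarrow> ('v list \<Rightarrow> 'v) \<Rightarrow> (nat \<Rightarrow> 'v \<Rightarrow> 'v) \<Rightarrow> nat \<Rightarrow> 'v list \<Rightarrow> 'v" where
  "hom_assoc_product n \<mu> \<eta> i as =
     \<mu> (map (\<lambda>j. if j < i then \<eta> j (as ! j)
                 else if j = i then \<mu> (take n (drop i as))
                 else \<eta> (j - 1) (as ! (j - 1 + n))) [0..<n])"

definition symmetric_totally_hom_assoc_algebra ::
  "('k, 'm) ring_scheme \<Rightarrow> nat \<Rightarrow> ('k, 'v, 'p) module_scheme \<Rightarrow> ('v list \<Rightarrow> 'v)
    \<Rightarrow> (nat \<Rightarrow> 'v \<Rightarrow> 'v) \<Rightarrow> bool" where
  "symmetric_totally_hom_assoc_algebra K n A \<mu> \<eta> \<longleftrightarrow>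
     vectorspace K A \<and>
     multilinear_map K n A A \<mu> \<and>
     (\<forall>as \<in> tuples n A. \<forall>\<sigma>. \<sigma> permutes {..<n} \<longrightarrow> \<mu> (permute_list \<sigma> as) = \<mu> as) \<and>
     (\<forall>i < n - 1. linear_map K A A (\<eta> i)) \<and>
     (\<forall>as \<in> tuples (2 * n - 1) A. \<forall>i < n. \<forall>j < n.
        hom_assoc_product n \<mu> \<eta> i as = hom_assoc_product n \<mu> \<eta> j as)"

definition hom_quadratic_symmetric_totally_hom_assoc_algebra ::
  "('k, 'm) ring_scheme \<Rightarrow> nat \<Rightarrow> ('k, 'v, 'p) module_scheme \<Rightarrow> ('v list \<Rightarrow> 'v)
    \<Rightarrow> (nat \<Rightarrow> 'v \<Rightarrow> 'v) \<Rightarrow> ('v \<Rightarrow> 'v \<Rightarrow> 'k) \<Rightarrow> ('v \<Rightarrow> 'v) \<Rightarrow> bool" where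
  "hom_quadratic_symmetric_totally_hom_assoc_algebra K n A \<mu> \<eta> B \<beta> \<longleftrightarrow>
     symmetric_totally_hom_assoc_algebra K n A \<mu> \<eta> \<and>
     bilinear_form K A B \<and> symmetric_form A B \<and> nondegenerate_form K A B \<and>
     linear_map K A A \<beta> \<and>
     (\<forall>i < n - 1. \<forall>a \<in> carrier A. \<forall>b \<in> carrier A. B (\<eta> i a) b = B a (\<eta> i b)) \<and>
     (\<forall>as \<in> tuples (n - 1) A. \<forall>b \<in> carrier A. \<forall>c \<in> carrier A.
        B (\<mu> (as @ [b])) (\<beta> c) = B (\<beta> b) (\<mu> (as @ [c])))"


section \<open>The tensor product of vector spaces\<close>

text \<open>
  The records of modules extend those of rings; the ring multiplication and unit play no role in
  a module.
\<close>

definition quotient_module ::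
  "('k, 'v, 'p) module_scheme \<Rightarrow> 'v set \<Rightarrow> ('k, 'v set) module" where
  "quotient_module V W =
     \<lparr>carrier = a_rcosets\<^bsub>V\<^esub> W, monoid.mult = undefined, one = undefined,
      zero = W, add = (<+>\<^bsub>V\<^esub>),
      smult = (\<lambda>c C. \<Union>x\<in>C. W +>\<^bsub>V\<^esub> c \<odot>\<^bsub>V\<^esub> x)\<rparr>"

definition free_module :: "('k, 'm) ring_scheme \<Rightarrow> 's set \<Rightarrow> ('k, 's \<Rightarrow> 'k) module" where
  "free_module K S =
     (ring.func_space K S)
       \<lparr>carrier := {f \<in> S \<rightarrow>\<^sub>E carrier K. finite {s \<in> S. f s \<noteq> \<zero>\<^bsub>K\<^esub>}}\<rparr>"

definition free_gen :: "('k, 'm) ring_scheme \<Rightarrow> 's set \<Rightarrow> 's \<Rightarrow> 's \<Rightarrow> 'k" where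
  "free_gen K S s = restrict (\<lambda>t. if t = s then \<one>\<^bsub>K\<^esub> else \<zero>\<^bsub>K\<^esub>) S"

definition tensor_relations ::
  "('k, 'm) ring_scheme \<Rightarrow> ('k, 'a, 'p) module_scheme \<Rightarrow> ('k, 'b, 'q) module_scheme
    \<Rightarrow> ('a \<times> 'b \<Rightarrow> 'k) set" where
  "tensor_relations K V W =
     (let S = carrier V \<times> carrier W; F = free_module K S; e = (\<lambda>v w. free_gen K S (v, w)) in
       {e (v \<oplus>\<^bsub>V\<^esub> v') w \<ominus>\<^bsub>F\<^esub> (e v w \<oplus>\<^bsub>F\<^esub> e v' w)
          | v v' w. v \<in> carrier V \<and> v' \<in> carrier V \<and> w \<in> carrier W} \<union>
       {e v (w \<oplus>\<^bsub>W\<^esub> w') \<ominus>\<^bsub>F\<^esub> (e v w \<oplus>\<^bsub>F\<^esub> e v w')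
          | v w w'. v \<in> carrier V \<and> w \<in> carrier W \<and> w' \<in> carrier W} \<union>
       {e (c \<odot>\<^bsub>V\<^esub> v) w \<ominus>\<^bsub>F\<^esub> c \<odot>\<^bsub>F\<^esub> e v w
          | c v w. c \<in> carrier K \<and> v \<in> carrier V \<and> w \<in> carrier W} \<union>
       {e v (c \<odot>\<^bsub>W\<^esub> w) \<ominus>\<^bsub>F\<^esub> c \<odot>\<^bsub>F\<^esub> e v w
          | c v w. c \<in> carrier K \<and> v \<in> carrier V \<and> w \<in> carrier W})"

definition tensor_kernel ::
  "('k, 'm) ring_scheme \<Rightarrow> ('k, 'a, 'p) module_scheme \<Rightarrow> ('k, 'b, 'q) module_scheme
    \<Rightarrow> ('a \<times> 'b \<Rightarrow> 'k) set" where
  "tensor_kernel K V W =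
     LinearCombinations.module.span K (free_module K (carrier V \<times> carrier W))
       (tensor_relations K V W)"

definition tensor_product ::
  "('k, 'm) ring_scheme \<Rightarrow> ('k, 'a, 'p) module_scheme \<Rightarrow> ('k, 'b, 'q) module_scheme
    \<Rightarrow> ('k, ('a \<times> 'b \<Rightarrow> 'k) set) module" where
  "tensor_product K V W =
     quotient_module (free_module K (carrier V \<times> carrier W)) (tensor_kernel K V W)"

definition pure_tensor ::
  "('k, 'm) ring_scheme \<Rightarrow> ('k, 'a, 'p) module_scheme \<Rightarrow> ('k, 'b, 'q) module_scheme
    \<Rightarrow> 'a \<Rightarrow> 'b \<Rightarrow> ('a \<times> 'b \<Rightarrow> 'k) set" where
  "pure_tensor K V W v w =
     tensor_kernel K V W +>\<^bsub>free_module K (carrier V \<times> carrier W)\<^esub>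
       free_gen K (carrier V \<times> carrier W) (v, w)"


section \<open>Multilinear extension from pure tensors\<close>

text \<open>
  Each predicate says that its last argument is a (multi)linear map with the prescribed values on
  pure tensors. As these span the tensor product, this determines the map on the carrier.
\<close>

definition is_tensor_operation ::
  "('k, 'm) ring_scheme \<Rightarrow> nat \<Rightarrow> ('k, 'a, 'p) module_scheme \<Rightarrow> ('k, 'b, 'q) module_scheme
    \<Rightarrow> ('a list \<Rightarrow> 'a) \<Rightarrow> ('b list \<Rightarrow> 'b)
    \<Rightarrow> (('a \<times> 'b \<Rightarrow> 'k) set list \<Rightarrow> ('a \<times> 'b \<Rightarrow> 'k) set) \<Rightarrow> bool" where
  "is_tensor_operation K n V W f g h \<longleftrightarrow>
     multilinear_map K n (tensor_product K V W) (tensor_product K V W) h \<and>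
     (\<forall>as \<in> tuples n V. \<forall>xs \<in> tuples n W.
        h (map2 (pure_tensor K V W) as xs) = pure_tensor K V W (f as) (g xs))"

definition is_tensor_map ::
  "('k, 'm) ring_scheme \<Rightarrow> ('k, 'a, 'p) module_scheme \<Rightarrow> ('k, 'b, 'q) module_scheme
    \<Rightarrow> ('a \<Rightarrow> 'a) \<Rightarrow> ('b \<Rightarrow> 'b)
    \<Rightarrow> (('a \<times> 'b \<Rightarrow> 'k) set \<Rightarrow> ('a \<times> 'b \<Rightarrow> 'k) set) \<Rightarrow> bool" where
  "is_tensor_map K V W f g h \<longleftrightarrow>
     linear_map K (tensor_product K V W) (tensor_product K V W) h \<and>
     (\<forall>a \<in> carrier V. \<forall>x \<in> carrier W.
        h (pure_tensor K V W a x) = pure_tensor K V W (f a) (g x))"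

definition is_tensor_form ::
  "('k, 'm) ring_scheme \<Rightarrow> ('k, 'a, 'p) module_scheme \<Rightarrow> ('k, 'b, 'q) module_scheme
    \<Rightarrow> ('a \<Rightarrow> 'a \<Rightarrow> 'k) \<Rightarrow> ('b \<Rightarrow> 'b \<Rightarrow> 'k)
    \<Rightarrow> (('a \<times> 'b \<Rightarrow> 'k) set \<Rightarrow> ('a \<times> 'b \<Rightarrow> 'k) set \<Rightarrow> 'k) \<Rightarrow> bool" where
  "is_tensor_form K V W B B' C \<longleftrightarrow>
     bilinear_form K (tensor_product K V W) C \<and>
     (\<forall>a \<in> carrier V. \<forall>x \<in> carrier W. \<forall>b \<in> carrier V. \<forall>y \<in> carrier W.
        C (pure_tensor K V W a x) (pure_tensor K V W b y) = B a b \<otimes>\<^bsub>K\<^esub> B' x y)"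

end

theory Submission
  imports Defs
begin

text \<open>
  Write \<open>T = A \<otimes> N\<close>. Total Hom-associativity together with symmetry makes the nested product of \<open>2n - 1\<close>
  elements of \<open>A\<close> invariant under all permutations, because every adjacent transposition takes place
  within some inner block. Hence all terms of the Hom-Nambu identity for pure tensors share the same
  \<open>A\<close>-factor, and the identity reduces to the one in \<open>N\<close>; multilinearity extends it to \<open>T\<close>. The
  invariance under \<open>\<omega>\<close> factors in the same way.

  For nondegeneracy, let \<open>t = \<Sum> a\<^sub>i \<otimes> x\<^sub>i\<close> be in the radical. For each \<open>b\<close>, the element
  \<open>\<Sum> B\<^sub>A(a\<^sub>i, b) x\<^sub>i\<close> is in the radical of \<open>B\<^sub>N\<close> and so vanishes. If \<open>B\<^sub>A(a\<^sub>1, b) \<noteq> 0\<close>, this expresses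
  \<open>x\<^sub>1\<close> through the other \<open>x\<^sub>i\<close>, so \<open>t\<close> is a sum of fewer pure tensors and \<open>t = 0\<close> by induction.
\<close>

section \<open>Linear and multilinear maps\<close>

text \<open>The bracket, the twisting maps and the form are prescribed only on pure tensors, so
  their existence is a claim of its own. It rests on the universal property of the concrete quotient
  of the free module, extended to arity \<open>n\<close> by adding one tensor slot at a time. The
  matching uniqueness principle proves identities on \<open>T\<close>, but only between functions
  that are multilinear in one tuple of independent arguments. This is why the Hom-Nambu identity is
  recast in \<open>2n - 1\<close> arguments and why the slot holding each of them is tracked.

  \<open>A\<close> and \<open>N\<close> may be infinite dimensional and no basis is chosen. A tensor
  is represented by a finite list of pairs, whose length takes the place of rank as induction
  measure. Nondegeneracy on \<open>A\<close> serves to find \<open>b\<close> for a nonzero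
  \<open>a\<^sub>1\<close>; nondegeneracy on \<open>N\<close> serves to make the contracted vector
  vanish.

  The sign in the invariance under \<open>\<omega>\<close> comes from \<open>N\<close> alone: the
  form on \<open>A\<close> is invariant without sign, so a common scalar factors out.\<close>

lemma linear_mapI:
  assumes "vectorspace K V" "vectorspace K W"
    and "\<And>x. x \<in> carrier V \<Longrightarrow> f x \<in> carrier W"
    and "\<And>x y. x \<in> carrier V \<Longrightarrow> y \<in> carrier V \<Longrightarrow> f (x \<oplus>\<^bsub>V\<^esub> y) = f x \<oplus>\<^bsub>W\<^esub> f y"
    and "\<And>c x. c \<in> carrier K \<Longrightarrow> x \<in> carrier V \<Longrightarrow> f (c \<odot>\<^bsub>V\<^esub> x) = c \<odot>\<^bsub>W\<^esub> f x"
  shows "linear_map K V W f"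
  using assms
  by (auto simp: linear_map_def mod_hom_def mod_hom_axioms_def module_hom_def vectorspace_def)

lemma linear_mapD:
  assumes "linear_map K V W f"
  shows "vectorspace K V" "vectorspace K W"
    and "\<And>x. x \<in> carrier V \<Longrightarrow> f x \<in> carrier W"
    and "\<And>x y. x \<in> carrier V \<Longrightarrow> y \<in> carrier V \<Longrightarrow> f (x \<oplus>\<^bsub>V\<^esub> y) = f x \<oplus>\<^bsub>W\<^esub> f y"
    and "\<And>c x. c \<in> carrier K \<Longrightarrow> x \<in> carrier V \<Longrightarrow> f (c \<odot>\<^bsub>V\<^esub> x) = c \<odot>\<^bsub>W\<^esub> f x"
  using assms
  by (auto simp: linear_map_def mod_hom_def mod_hom_axioms_def module_hom_def)

lemma linear_map_zero:
  assumes "linear_map K V W f"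
  shows "f \<zero>\<^bsub>V\<^esub> = \<zero>\<^bsub>W\<^esub>"
proof -
  interpret linear_map K V W f by fact
  show ?thesis by simp
qed

text \<open>Linearity constrains values on the carrier only, so a formula that is valid merely there
  is enough to transfer it.\<close>

lemma linear_map_cong:
  assumes "\<And>x. x \<in> carrier V \<Longrightarrow> f x = g x" and "linear_map K V W g"
  shows "linear_map K V W f"
proof -
  note g = linear_mapD[OF assms(2)]
  interpret V: vectorspace K V by (rule g)
  show ?thesis by (rule linear_mapI) (auto simp: assms(1) g)
qed

lemma linear_map_compose:
  assumes "linear_map K V W f" "linear_map K U V g"
  shows "linear_map K U W (\<lambda>x. f (g x))"
  by (rule linear_mapI) (simp_all add: linear_mapD[OF assms(1)] linear_mapD[OF assms(2)])

lemma linear_map_const_zero: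
  assumes "vectorspace K V" "vectorspace K W"
  shows "linear_map K V W (\<lambda>x. \<zero>\<^bsub>W\<^esub>)"
proof -
  interpret W: vectorspace K W by fact
  show ?thesis by (rule linear_mapI[OF assms]) simp_all
qed

lemma linear_map_plus:
  assumes "linear_map K V W f" "linear_map K V W g"
  shows "linear_map K V W (\<lambda>x. f x \<oplus>\<^bsub>W\<^esub> g x)"
proof -
  note f = linear_mapD[OF assms(1)] and g = linear_mapD[OF assms(2)]
  interpret W: vectorspace K W by (rule f)
  show ?thesis
    by (rule linear_mapI) (simp_all add: f g W.M.a_ac W.smult_r_distr)
qed

lemma linear_map_scale:
  assumes "linear_map K V W f" and c: "c \<in> carrier K"
  shows "linear_map K V W (\<lambda>x. c \<odot>\<^bsub>W\<^esub> f x)"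
proof -
  note f = linear_mapD[OF assms(1)]
  interpret W: vectorspace K W by (rule f)
  show ?thesis
    by (rule linear_mapI)
      (simp_all add: f c W.smult_r_distr W.smult_assoc1[symmetric] W.R.m_comm)
qed

lemma linear_map_finsum:
  assumes V: "vectorspace K V" and W: "vectorspace K W" and "finite I"
    and "\<And>i. i \<in> I \<Longrightarrow> linear_map K V W (f i)"
  shows "linear_map K V W (\<lambda>x. \<Oplus>\<^bsub>W\<^esub>i\<in>I. f i x)"
proof -
  interpret W: vectorspace K W by fact
  show ?thesis
    using assms(3,4)
  proof (induction I)
    case empty
    show ?case using linear_map_const_zero[OF V W] by simp
  next
    case (insert i I)
    have "linear_map K V W (\<lambda>x. f i x \<oplus>\<^bsub>W\<^esub> (\<Oplus>\<^bsub>W\<^esub>j\<in>I. f j x))"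
      using insert by (intro linear_map_plus) auto
    moreover have "(\<Oplus>\<^bsub>W\<^esub>j\<in>insert i I. f j x) = f i x \<oplus>\<^bsub>W\<^esub> (\<Oplus>\<^bsub>W\<^esub>j\<in>I. f j x)"
      if "x \<in> carrier V" for x
      using insert(1,2) linear_mapD(3)[OF insert.prems] that by (intro W.M.finsum_insert) auto
    ultimately show ?case by (rule linear_map_cong[rotated])
  qed
qed

section \<open>Tuples and linearity in a single slot\<close>

lemma tuples_nth: "xs \<in> tuples n V \<Longrightarrow> i < n \<Longrightarrow> xs ! i \<in> carrier V"
  by (auto simp: tuples_def)

lemma tuples_update: "xs \<in> tuples n V \<Longrightarrow> v \<in> carrier V \<Longrightarrow> xs[i := v] \<in> tuples n V"
  by (auto simp: tuples_def dest: subsetD[OF set_update_subset_insert])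

lemma tuples_map_upt:
  "map f [0..<n] \<in> tuples n V \<longleftrightarrow> (\<forall>i<n. f i \<in> carrier V)"
  by (auto simp: tuples_def)

lemma multilinear_map_slot:
  assumes "multilinear_map K n V W f" "vectorspace K V" "vectorspace K W"
    and "xs \<in> tuples n V" "i < n"
  shows "linear_map K V W (\<lambda>v. f (xs[i := v]))"
  using assms by (intro linear_mapI) (auto simp: multilinear_map_def tuples_update)

lemma multilinear_mapI:
  assumes "\<And>xs. xs \<in> tuples n V \<Longrightarrow> f xs \<in> carrier W"
    and "\<And>xs i. xs \<in> tuples n V \<Longrightarrow> i < n \<Longrightarrow> linear_map K V W (\<lambda>v. f (xs[i := v]))"
  shows "multilinear_map K n V W f"
  unfolding multilinear_map_def
  using assms(1) linear_mapD(4,5)[OF assms(2)] by blast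

lemma multilinear_map_closed:
  "multilinear_map K n V W f \<Longrightarrow> xs \<in> tuples n V \<Longrightarrow> f xs \<in> carrier W"
  by (auto simp: multilinear_map_def)

text \<open>The tool for nested brackets: varying one argument of the whole expression changes a
  single outer slot \<open>j\<close>, and does so linearly, while all other slots keep constant
  values \<open>c k\<close>.\<close>

lemma linear_map_slot_compose:
  assumes f: "multilinear_map K n V W f" and W: "vectorspace K W"
    and j: "j < n" and g: "linear_map K U V (\<lambda>v. g v j)"
    and c: "\<And>k. k < n \<Longrightarrow> k \<noteq> j \<Longrightarrow> c k \<in> carrier V"
    and gc: "\<And>k v. k < n \<Longrightarrow> k \<noteq> j \<Longrightarrow> v \<in> carrier U \<Longrightarrow> g v k = c k"
  shows "linear_map K U W (\<lambda>v. f (map (g v) [0..<n]))"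
proof -
  note V = linear_mapD(2)[OF g]
  interpret V: vectorspace K V by (rule V)
  \<comment> \<open>Slot \<open>j\<close> is overwritten in every use; the zero there only makes the
    list a legal tuple, as nothing is known about \<open>c j\<close>.\<close>
  let ?xs = "map (c(j := \<zero>\<^bsub>V\<^esub>)) [0..<n]"
  have "?xs \<in> tuples n V" using c by (auto simp: tuples_map_upt)
  from linear_map_compose[OF multilinear_map_slot[OF f V W this j] g]
  show ?thesis
  proof (rule linear_map_cong[rotated])
    fix v assume "v \<in> carrier U"
    then show "f (map (g v) [0..<n]) = f (?xs[j := g v j])"
      by (intro arg_cong[of _ _ f] nth_equalityI) (auto simp: nth_list_update gc j)
  qed
qed

section \<open>Quotient and free modules\<close>

lemma quotient_module_carrier:
  "carrier (quotient_module V U) = (\<lambda>x. U +>\<^bsub>V\<^esub> x) ` carrier V"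
  by (auto simp: quotient_module_def A_RCOSETS_def' a_r_coset_def')

text \<open>\<open>linear_map\<close> contains the vector space property of both ends, so the first
  conclusion also supplies the structure on the quotient.\<close>

lemma quotient_map_linear:
  assumes V: "vectorspace K V" and U: "subspace K U V"
  shows "linear_map K V (quotient_module V U) (\<lambda>x. U +>\<^bsub>V\<^esub> x)"
    and "\<And>x. x \<in> carrier V \<Longrightarrow> U +>\<^bsub>V\<^esub> x = U \<longleftrightarrow> x \<in> U"
    and "U = \<zero>\<^bsub>quotient_module V U\<^esub>"
proof -
  interpret V: vectorspace K V by fact
  interpret U: LinearCombinations.submodule K U V using U by (simp add: subspace_def)
  have neg: "\<ominus>\<^bsub>V\<^esub> x \<in> U" if "x \<in> U" for x
    using that U.subset U.smult_closed[of "\<ominus>\<^bsub>K\<^esub> \<one>\<^bsub>K\<^esub>" x] by (auto simp: V.smult_minus_1 subset_iff)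
  have "additive_subgroup U V"
    using U.subset neg by (intro additive_subgroupI V.M.add.subgroupI)
      (auto simp: a_inv_def[symmetric] intro: U.zero_closed)
  then interpret U: abelian_subgroup U V
    by (intro abelian_subgroupI3) (auto intro: V.M.abelian_group_axioms)
  let ?Q = "quotient_module V U" and ?q = "\<lambda>x. U +>\<^bsub>V\<^esub> x"
  have add: "?q x \<oplus>\<^bsub>?Q\<^esub> ?q y = ?q (x \<oplus>\<^bsub>V\<^esub> y)" if "x \<in> carrier V" "y \<in> carrier V" for x y
    using that by (simp add: quotient_module_def U.a_rcos_sum)
  have smult: "c \<odot>\<^bsub>?Q\<^esub> ?q x = ?q (c \<odot>\<^bsub>V\<^esub> x)" if c: "c \<in> carrier K" and x: "x \<in> carrier V" for c x
  proof -
    \<comment> \<open>Scaling of cosets is a union over all representatives; it is a single coset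
      because every representative contributes the same one.\<close>
    have "?q (c \<odot>\<^bsub>V\<^esub> y) = ?q (c \<odot>\<^bsub>V\<^esub> x)" if "y \<in> ?q x" for y
    proof -
      from that obtain u where u: "u \<in> U" "y = u \<oplus>\<^bsub>V\<^esub> x" by (auto simp: a_r_coset_def')
      then have "c \<odot>\<^bsub>V\<^esub> y = c \<odot>\<^bsub>V\<^esub> u \<oplus>\<^bsub>V\<^esub> c \<odot>\<^bsub>V\<^esub> x"
        using c x U.subset by (auto simp: V.smult_r_distr)
      moreover have "c \<odot>\<^bsub>V\<^esub> u \<in> U" using c u by simp
      ultimately have "c \<odot>\<^bsub>V\<^esub> y \<in> ?q (c \<odot>\<^bsub>V\<^esub> x)" by (auto simp: a_r_coset_def')
      then show ?thesis using c x by (metis U.a_repr_independence' V.smult_closed)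
    qed
    moreover have "x \<in> ?q x" using x by (rule U.a_rcos_self)
    ultimately have "(\<Union>y\<in>?q x. ?q (c \<odot>\<^bsub>V\<^esub> y)) = ?q (c \<odot>\<^bsub>V\<^esub> x)" by blast
    then show ?thesis by (simp add: quotient_module_def)
  qed
  show zero: "U = \<zero>\<^bsub>?Q\<^esub>" by (simp add: quotient_module_def)
  have q0: "?q \<zero>\<^bsub>V\<^esub> = \<zero>\<^bsub>?Q\<^esub>" using U.a_subset by (simp add: quotient_module_def)
  have neg': "\<exists>y\<in>carrier V. ?q (x \<oplus>\<^bsub>V\<^esub> y) = ?q \<zero>\<^bsub>V\<^esub>" if "x \<in> carrier V" for x
    using that by (intro bexI[of _ "\<ominus>\<^bsub>V\<^esub> x"]) (auto simp: V.M.r_neg)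
  have "vectorspace K ?Q"
  proof (rule vs_criteria[OF V.field_axioms])
    show "\<forall>v\<in>carrier ?Q. \<exists>w\<in>carrier ?Q. v \<oplus>\<^bsub>?Q\<^esub> w = \<zero>\<^bsub>?Q\<^esub>"
      using neg' by (auto simp: quotient_module_carrier add q0)
  qed (auto simp: quotient_module_carrier add smult q0[symmetric] V.M.a_ac V.smult_assoc1
        V.smult_l_distr V.smult_r_distr)
  then show "linear_map K V ?Q ?q"
    by (intro linear_mapI V.vectorspace_axioms) (auto simp: quotient_module_carrier add smult)
  show "?q x = U \<longleftrightarrow> x \<in> U" if "x \<in> carrier V" for x
    using U.a_rcos_self[OF that] U.a_rcos_const by auto
qed

text \<open>Finitely supported functions form a subspace of all functions: the support of a sum lies
  in the union of the two supports, and scaling does not enlarge a support.\<close>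

lemma free_module_vectorspace:
  assumes "field K"
  shows "vectorspace K (free_module K S)"
proof -
  interpret K: field K by fact
  let ?E = "LinearCombinations.ring.func_space K S"
  have E: "vectorspace K ?E"
    using K.func_space_is_module K.field_axioms by (simp add: vectorspace_def)
  interpret E: vectorspace K ?E by (rule E)
  let ?C = "{f \<in> S \<rightarrow>\<^sub>E carrier K. finite {s \<in> S. f s \<noteq> \<zero>\<^bsub>K\<^esub>}}"
  have "finite {s \<in> S. f s \<oplus>\<^bsub>K\<^esub> g s \<noteq> \<zero>\<^bsub>K\<^esub>}"
    if "finite {s \<in> S. f s \<noteq> \<zero>\<^bsub>K\<^esub>}" "finite {s \<in> S. g s \<noteq> \<zero>\<^bsub>K\<^esub>}" for f g
    by (rule finite_subset[OF _ finite_UnI[OF that]]) auto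
  moreover have "finite {s \<in> S. c \<otimes>\<^bsub>K\<^esub> f s \<noteq> \<zero>\<^bsub>K\<^esub>}"
    if "finite {s \<in> S. f s \<noteq> \<zero>\<^bsub>K\<^esub>}" "c \<in> carrier K" for f c
    by (rule finite_subset[OF _ that(1)]) (use that(2) in auto)
  ultimately have "LinearCombinations.submodule K ?C ?E"
    by (intro LinearCombinations.submodule.intro E.module_axioms)
      (auto simp: K.func_space_def PiE_mem cong: conj_cong)
  then have "subspace K ?C ?E" using E by (simp add: subspace_def)
  from E.subspace_is_vs[OF this] show ?thesis by (simp add: free_module_def)
qed

lemma free_module_simps:
  assumes "field K"
  shows "carrier (free_module K S) = {f \<in> S \<rightarrow>\<^sub>E carrier K. finite {s \<in> S. f s \<noteq> \<zero>\<^bsub>K\<^esub>}}"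
    and "f \<oplus>\<^bsub>free_module K S\<^esub> g = restrict (\<lambda>s. f s \<oplus>\<^bsub>K\<^esub> g s) S"
    and "c \<odot>\<^bsub>free_module K S\<^esub> f = restrict (\<lambda>s. c \<otimes>\<^bsub>K\<^esub> f s) S"
    and "\<zero>\<^bsub>free_module K S\<^esub> = restrict (\<lambda>s. \<zero>\<^bsub>K\<^esub>) S"
proof -
  interpret K: field K by fact
  show "carrier (free_module K S) = {f \<in> S \<rightarrow>\<^sub>E carrier K. finite {s \<in> S. f s \<noteq> \<zero>\<^bsub>K\<^esub>}}"
    and "f \<oplus>\<^bsub>free_module K S\<^esub> g = restrict (\<lambda>s. f s \<oplus>\<^bsub>K\<^esub> g s) S"
    and "c \<odot>\<^bsub>free_module K S\<^esub> f = restrict (\<lambda>s. c \<otimes>\<^bsub>K\<^esub> f s) S"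
    and "\<zero>\<^bsub>free_module K S\<^esub> = restrict (\<lambda>s. \<zero>\<^bsub>K\<^esub>) S"
    by (simp_all add: free_module_def K.func_space_def)
qed

lemma free_gen_closed:
  assumes "field K" and "s \<in> S"
  shows "free_gen K S s \<in> carrier (free_module K S)"
proof -
  interpret K: field K by fact
  have "{t \<in> S. free_gen K S s t \<noteq> \<zero>\<^bsub>K\<^esub>} \<subseteq> {s}" by (auto simp: free_gen_def split: if_splits)
  then have "finite {t \<in> S. free_gen K S s t \<noteq> \<zero>\<^bsub>K\<^esub>}" by (rule finite_subset) simp
  then show ?thesis by (auto simp: free_module_simps[OF assms(1)]) (auto simp: free_gen_def)
qed

text \<open>Induction on a finite set that contains the support. Containment instead of equality
  lets a step remove a point whether or not the coefficient there vanishes.\<close>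

lemma free_module_induct [consumes 2, case_names zero gen add smult]:
  assumes K: "field K" and f: "f \<in> carrier (free_module K S)"
    and zero: "P \<zero>\<^bsub>free_module K S\<^esub>"
    and gen: "\<And>s. s \<in> S \<Longrightarrow> P (free_gen K S s)"
    and add: "\<And>f g. f \<in> carrier (free_module K S) \<Longrightarrow> g \<in> carrier (free_module K S) \<Longrightarrow>
      P f \<Longrightarrow> P g \<Longrightarrow> P (f \<oplus>\<^bsub>free_module K S\<^esub> g)"
    and smult: "\<And>c f. c \<in> carrier K \<Longrightarrow> f \<in> carrier (free_module K S) \<Longrightarrow> P f \<Longrightarrow>
      P (c \<odot>\<^bsub>free_module K S\<^esub> f)"
  shows "P f"
proof -
  interpret K: field K by fact
  interpret F: vectorspace K "free_module K S" by (rule free_module_vectorspace[OF K])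
  note simps = free_module_simps[OF K]
  let ?F = "free_module K S"
  have "\<forall>f\<in>carrier ?F. {s \<in> S. f s \<noteq> \<zero>\<^bsub>K\<^esub>} \<subseteq> A \<longrightarrow> P f" if "finite A" "A \<subseteq> S" for A
    using that
  proof (induction A rule: finite_subset_induct)
    case empty
    have "f = \<zero>\<^bsub>?F\<^esub>" if "f \<in> carrier ?F" "{s \<in> S. f s \<noteq> \<zero>\<^bsub>K\<^esub>} \<subseteq> {}" for f
      using that by (intro extensionalityI[of _ S]) (auto simp: simps PiE_iff)
    then show ?case using zero by blast
  next
    case (insert a A)
    show ?case
    proof (intro ballI impI)
      fix f assume f: "f \<in> carrier ?F" and supp: "{s \<in> S. f s \<noteq> \<zero>\<^bsub>K\<^esub>} \<subseteq> insert a A"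
      \<comment> \<open>\<open>g\<close> is \<open>f\<close> without its coefficient at
        \<open>a\<close>, so its support lies in \<open>A\<close> and \<open>f\<close> differs from
        it by a multiple of one generator.\<close>
      define g where "g = f(a := \<zero>\<^bsub>K\<^esub>)"
      have fa: "f a \<in> carrier K" using f insert.hyps(2) by (auto simp: simps)
      have sub: "{s \<in> S. g s \<noteq> \<zero>\<^bsub>K\<^esub>} \<subseteq> A" using supp by (auto simp: g_def)
      then have "finite {s \<in> S. g s \<noteq> \<zero>\<^bsub>K\<^esub>}" using insert.hyps(1) by (rule finite_subset)
      moreover have "g \<in> S \<rightarrow>\<^sub>E carrier K"
        using f insert.hyps(2) by (auto simp: simps g_def PiE_iff extensional_def)
      ultimately have g: "g \<in> carrier ?F" by (simp add: simps)
      have "f = g \<oplus>\<^bsub>?F\<^esub> f a \<odot>\<^bsub>?F\<^esub> free_gen K S a"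
        using f fa by (intro extensionalityI[of _ S])
          (auto simp: simps g_def free_gen_def PiE_iff insert.hyps(2))
      moreover have "P g" using insert.IH g sub by blast
      ultimately show "P f"
        using add[OF g F.smult_closed[OF fa free_gen_closed[OF K insert.hyps(2)]]]
          smult[OF fa free_gen_closed[OF K insert.hyps(2)] gen[OF insert.hyps(2)]] by simp
    qed
  qed
  then show ?thesis using f by (auto simp: simps)
qed

text \<open>The linear extension of a map from the generators, as given by the universal property of
  the free module. The support is finite on the carrier, so the sum is a genuine one there.\<close>

definition free_lift ::
  "('k, 'm) ring_scheme \<Rightarrow> 's set \<Rightarrow> ('k, 'z, 'r) module_scheme \<Rightarrow> ('s \<Rightarrow> 'z) \<Rightarrow> ('s \<Rightarrow> 'k) \<Rightarrow> 'z"
  where "free_lift K S Z \<phi> f = (\<Oplus>\<^bsub>Z\<^esub>s\<in>{s \<in> S. f s \<noteq> \<zero>\<^bsub>K\<^esub>}. f s \<odot>\<^bsub>Z\<^esub> \<phi> s)"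

text \<open>The supports of \<open>f\<close>, \<open>g\<close> and their sum differ in general;
  additivity needs all three sums over one common finite index set.\<close>

lemma free_lift_superset:
  assumes Z: "vectorspace K Z" and \<phi>: "\<And>s. s \<in> S \<Longrightarrow> \<phi> s \<in> carrier Z"
    and f: "f \<in> carrier (free_module K S)"
    and A: "finite A" "{s \<in> S. f s \<noteq> \<zero>\<^bsub>K\<^esub>} \<subseteq> A" "A \<subseteq> S"
  shows "free_lift K S Z \<phi> f = (\<Oplus>\<^bsub>Z\<^esub>s\<in>A. f s \<odot>\<^bsub>Z\<^esub> \<phi> s)"
proof -
  interpret Z: vectorspace K Z by fact
  note simps = free_module_simps[OF Z.field_axioms]
  have "f s \<odot>\<^bsub>Z\<^esub> \<phi> s \<in> carrier Z" if "s \<in> S" for s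
    using f \<phi> that by (auto simp: simps)
  then show ?thesis
    unfolding free_lift_def using A \<phi>
    by (intro Z.M.add.finprod_mono_neutral_cong_left) (auto simp: subset_iff)
qed

lemma free_lift_linear:
  assumes Z: "vectorspace K Z" and \<phi>: "\<And>s. s \<in> S \<Longrightarrow> \<phi> s \<in> carrier Z"
  shows "linear_map K (free_module K S) Z (free_lift K S Z \<phi>)"
proof -
  interpret Z: vectorspace K Z by fact
  note simps = free_module_simps[OF Z.field_axioms]
  let ?F = "free_module K S" and ?L = "free_lift K S Z \<phi>"
  interpret F: vectorspace K ?F by (rule free_module_vectorspace[OF Z.field_axioms])
  note sup = free_lift_superset[of K Z S \<phi>, OF Z \<phi>]
  have val: "f s \<in> carrier K" if "f \<in> carrier ?F" "s \<in> S" for f s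
    using that by (auto simp: simps)
  have fin: "finite {s \<in> S. f s \<noteq> \<zero>\<^bsub>K\<^esub>}" if "f \<in> carrier ?F" for f
    using that by (auto simp: simps)
  show ?thesis
  proof (rule linear_mapI)
    show "?L f \<in> carrier Z" if "f \<in> carrier ?F" for f
      using val[OF that] \<phi> by (auto simp: free_lift_def intro!: Z.M.finsum_closed)
    show "?L (f \<oplus>\<^bsub>?F\<^esub> g) = ?L f \<oplus>\<^bsub>Z\<^esub> ?L g" if fg: "f \<in> carrier ?F" "g \<in> carrier ?F" for f g
    proof -
      let ?A = "{s \<in> S. f s \<noteq> \<zero>\<^bsub>K\<^esub>} \<union> {s \<in> S. g s \<noteq> \<zero>\<^bsub>K\<^esub>}"
      have "?L (f \<oplus>\<^bsub>?F\<^esub> g) = (\<Oplus>\<^bsub>Z\<^esub>s\<in>?A. (f \<oplus>\<^bsub>?F\<^esub> g) s \<odot>\<^bsub>Z\<^esub> \<phi> s)"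
        using fg fin by (intro sup F.M.a_closed) (auto simp: simps(2))
      also have "\<dots> = (\<Oplus>\<^bsub>Z\<^esub>s\<in>?A. f s \<odot>\<^bsub>Z\<^esub> \<phi> s \<oplus>\<^bsub>Z\<^esub> g s \<odot>\<^bsub>Z\<^esub> \<phi> s)"
        using val[OF fg(1)] val[OF fg(2)] \<phi>
        by (intro Z.M.finsum_cong') (auto simp: simps(2) Z.smult_l_distr)
      also have "\<dots> = (\<Oplus>\<^bsub>Z\<^esub>s\<in>?A. f s \<odot>\<^bsub>Z\<^esub> \<phi> s) \<oplus>\<^bsub>Z\<^esub> (\<Oplus>\<^bsub>Z\<^esub>s\<in>?A. g s \<odot>\<^bsub>Z\<^esub> \<phi> s)"
        using val[OF fg(1)] val[OF fg(2)] \<phi> by (intro Z.M.finsum_addf) auto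
      also have "(\<Oplus>\<^bsub>Z\<^esub>s\<in>?A. f s \<odot>\<^bsub>Z\<^esub> \<phi> s) = ?L f"
        using fg fin by (intro sup[symmetric]) auto
      also have "(\<Oplus>\<^bsub>Z\<^esub>s\<in>?A. g s \<odot>\<^bsub>Z\<^esub> \<phi> s) = ?L g"
        using fg fin by (intro sup[symmetric]) auto
      finally show ?thesis .
    qed
    show "?L (c \<odot>\<^bsub>?F\<^esub> f) = c \<odot>\<^bsub>Z\<^esub> ?L f" if c: "c \<in> carrier K" and f: "f \<in> carrier ?F" for c f
    proof -
      let ?A = "{s \<in> S. f s \<noteq> \<zero>\<^bsub>K\<^esub>}"
      have "?L (c \<odot>\<^bsub>?F\<^esub> f) = (\<Oplus>\<^bsub>Z\<^esub>s\<in>?A. (c \<odot>\<^bsub>?F\<^esub> f) s \<odot>\<^bsub>Z\<^esub> \<phi> s)"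
        using c f fin by (intro sup F.smult_closed) (auto simp: simps(3))
      also have "\<dots> = (\<Oplus>\<^bsub>Z\<^esub>s\<in>?A. c \<odot>\<^bsub>Z\<^esub> (f s \<odot>\<^bsub>Z\<^esub> \<phi> s))"
        using val[OF f] \<phi> c
        by (intro Z.M.finsum_cong') (auto simp: simps(3) Z.smult_assoc1)
      also have "\<dots> = c \<odot>\<^bsub>Z\<^esub> (\<Oplus>\<^bsub>Z\<^esub>s\<in>?A. f s \<odot>\<^bsub>Z\<^esub> \<phi> s)"
        using val[OF f] \<phi> c fin[OF f] by (intro Z.finsum_smult_ldistr[symmetric]) auto
      finally show ?thesis by (simp add: free_lift_def)
    qed
  qed (rule F.vectorspace_axioms, rule Z)
qed

lemma free_lift_gen:
  assumes Z: "vectorspace K Z" and \<phi>: "\<And>s. s \<in> S \<Longrightarrow> \<phi> s \<in> carrier Z" and s: "s \<in> S"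
  shows "free_lift K S Z \<phi> (free_gen K S s) = \<phi> s"
proof -
  interpret Z: vectorspace K Z by fact
  have "free_lift K S Z \<phi> (free_gen K S s) = (\<Oplus>\<^bsub>Z\<^esub>t\<in>{s}. free_gen K S s t \<odot>\<^bsub>Z\<^esub> \<phi> t)"
    using s by (intro free_lift_superset[OF Z \<phi>] free_gen_closed Z.field_axioms)
      (auto simp: free_gen_def)
  also have "\<dots> = free_gen K S s s \<odot>\<^bsub>Z\<^esub> \<phi> s"
    using s \<phi> by (simp add: free_gen_def)
  finally show ?thesis using s \<phi> by (simp add: free_gen_def)
qed

section \<open>The tensor product\<close>

text \<open>Phrased through \<open>linear_map\<close>, so that closure under composition, sums and
  scaling applies to each argument separately.\<close>

definition bilinear_map ::
  "('k, 'm) ring_scheme \<Rightarrow> ('k, 'a, 'p) module_scheme \<Rightarrow> ('k, 'b, 'q) module_scheme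
    \<Rightarrow> ('k, 'z, 'r) module_scheme \<Rightarrow> ('a \<Rightarrow> 'b \<Rightarrow> 'z) \<Rightarrow> bool" where
  "bilinear_map K V W Z \<phi> \<longleftrightarrow>
     (\<forall>w \<in> carrier W. linear_map K V Z (\<lambda>v. \<phi> v w)) \<and> (\<forall>v \<in> carrier V. linear_map K W Z (\<phi> v))"

lemma bilinear_mapD:
  assumes "bilinear_map K V W Z \<phi>"
  shows "w \<in> carrier W \<Longrightarrow> linear_map K V Z (\<lambda>v. \<phi> v w)"
    and "v \<in> carrier V \<Longrightarrow> linear_map K W Z (\<phi> v)"
    and "v \<in> carrier V \<Longrightarrow> w \<in> carrier W \<Longrightarrow> \<phi> v w \<in> carrier Z"
proof -
  show V: "w \<in> carrier W \<Longrightarrow> linear_map K V Z (\<lambda>v. \<phi> v w)"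
    and "v \<in> carrier V \<Longrightarrow> linear_map K W Z (\<phi> v)"
    using assms by (simp_all add: bilinear_map_def)
  show "v \<in> carrier V \<Longrightarrow> w \<in> carrier W \<Longrightarrow> \<phi> v w \<in> carrier Z"
    using linear_mapD(3)[OF V] .
qed

locale tensor_factors =
  fixes K :: "('k, 'm) ring_scheme"
    and V :: "('k, 'a, 'p) module_scheme"
    and W :: "('k, 'b, 'q) module_scheme"
  assumes V: "vectorspace K V" and W: "vectorspace K W"
begin

sublocale V: vectorspace K V by (rule V)
sublocale W: vectorspace K W by (rule W)

abbreviation "S \<equiv> carrier V \<times> carrier W"
abbreviation "F \<equiv> free_module K S"
abbreviation "T \<equiv> tensor_product K V W"
abbreviation "pt \<equiv> pure_tensor K V W"
abbreviation "e v w \<equiv> free_gen K S (v, w)"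
abbreviation "q f \<equiv> tensor_kernel K V W +>\<^bsub>F\<^esub> f"

interpretation F: vectorspace K F
  by (rule free_module_vectorspace[OF V.field_axioms])

text \<open>Serves two choices of \<open>R\<close>: the carrier of the free module, and the kernel
  of the linear extension of a bilinear map.\<close>

lemma tensor_relations_subsetI:
  assumes "\<And>v v' w. v \<in> carrier V \<Longrightarrow> v' \<in> carrier V \<Longrightarrow> w \<in> carrier W \<Longrightarrow>
      e (v \<oplus>\<^bsub>V\<^esub> v') w \<ominus>\<^bsub>F\<^esub> (e v w \<oplus>\<^bsub>F\<^esub> e v' w) \<in> R"
    and "\<And>v w w'. v \<in> carrier V \<Longrightarrow> w \<in> carrier W \<Longrightarrow> w' \<in> carrier W \<Longrightarrow>
      e v (w \<oplus>\<^bsub>W\<^esub> w') \<ominus>\<^bsub>F\<^esub> (e v w \<oplus>\<^bsub>F\<^esub> e v w') \<in> R"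
    and "\<And>c v w. c \<in> carrier K \<Longrightarrow> v \<in> carrier V \<Longrightarrow> w \<in> carrier W \<Longrightarrow>
      e (c \<odot>\<^bsub>V\<^esub> v) w \<ominus>\<^bsub>F\<^esub> c \<odot>\<^bsub>F\<^esub> e v w \<in> R"
    and "\<And>c v w. c \<in> carrier K \<Longrightarrow> v \<in> carrier V \<Longrightarrow> w \<in> carrier W \<Longrightarrow>
      e v (c \<odot>\<^bsub>W\<^esub> w) \<ominus>\<^bsub>F\<^esub> c \<odot>\<^bsub>F\<^esub> e v w \<in> R"
  shows "tensor_relations K V W \<subseteq> R"
  unfolding tensor_relations_def Let_def
  by (intro Un_least subsetI; elim CollectE exE conjE; hypsubst; intro assms; assumption)

lemma free_gen_pair_closed: "v \<in> carrier V \<Longrightarrow> w \<in> carrier W \<Longrightarrow> e v w \<in> carrier F"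
  by (auto intro: free_gen_closed V.field_axioms)

lemma tensor_relations_subset: "tensor_relations K V W \<subseteq> carrier F"
  by (rule tensor_relations_subsetI)
    (auto simp: free_gen_pair_closed intro!: F.M.minus_closed)

lemma tensor_kernel_subspace: "subspace K (tensor_kernel K V W) F"
  unfolding tensor_kernel_def by (rule F.span_is_subspace[OF tensor_relations_subset])

lemma tensor_coset_linear: "linear_map K F T (\<lambda>f. q f)"
  unfolding tensor_product_def
  by (rule quotient_map_linear(1)[OF F.vectorspace_axioms tensor_kernel_subspace])

lemma tensor_vectorspace: "vectorspace K T"
  by (rule linear_mapD(2)[OF tensor_coset_linear])

sublocale T: vectorspace K T by (rule tensor_vectorspace)
interpretation q: linear_map K F T "\<lambda>f. q f" by (rule tensor_coset_linear)

lemma tensor_coset_eq_iff: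
  assumes "f \<in> carrier F" "g \<in> carrier F"
  shows "q f = q g \<longleftrightarrow> f \<ominus>\<^bsub>F\<^esub> g \<in> tensor_kernel K V W"
proof -
  have "q (f \<ominus>\<^bsub>F\<^esub> g) = tensor_kernel K V W \<longleftrightarrow> f \<ominus>\<^bsub>F\<^esub> g \<in> tensor_kernel K V W"
    by (intro quotient_map_linear(2)[OF F.vectorspace_axioms tensor_kernel_subspace]
        F.M.minus_closed assms)
  moreover have "tensor_kernel K V W = \<zero>\<^bsub>T\<^esub>"
    unfolding tensor_product_def
    by (rule quotient_map_linear(3)[OF F.vectorspace_axioms tensor_kernel_subspace])
  moreover have "q (f \<ominus>\<^bsub>F\<^esub> g) = q f \<ominus>\<^bsub>T\<^esub> q g" using assms by (rule q.T_minus)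
  moreover have "q f \<ominus>\<^bsub>T\<^esub> q g = \<zero>\<^bsub>T\<^esub> \<longleftrightarrow> q f = q g"
    using assms by (intro T.M.minus_other_side q.T_im)
  ultimately show ?thesis by (simp only:)
qed

lemma tensor_coset_eqI:
  assumes "f \<in> carrier F" "g \<in> carrier F" "f \<ominus>\<^bsub>F\<^esub> g \<in> tensor_relations K V W"
  shows "q f = q g"
proof -
  have "f \<ominus>\<^bsub>F\<^esub> g \<in> tensor_kernel K V W"
    unfolding tensor_kernel_def
    by (rule subsetD[OF F.in_own_span[OF tensor_relations_subset] assms(3)])
  then show ?thesis by (simp only: tensor_coset_eq_iff[OF assms(1,2)])
qed

text \<open>Each of the four laws is one family of relations, and the quotient map sends every
  relation to zero.\<close>

lemma pure_tensor_bilinear: "bilinear_map K V W T pt"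
proof -
  have "pt (v \<oplus>\<^bsub>V\<^esub> v') w = pt v w \<oplus>\<^bsub>T\<^esub> pt v' w"
    if "v \<in> carrier V" "v' \<in> carrier V" "w \<in> carrier W" for v v' w
  proof -
    have "q (e (v \<oplus>\<^bsub>V\<^esub> v') w) = q (e v w \<oplus>\<^bsub>F\<^esub> e v' w)"
      using that by (intro tensor_coset_eqI) (auto simp: free_gen_pair_closed tensor_relations_def Let_def)
    then show ?thesis using that by (simp add: pure_tensor_def free_gen_pair_closed)
  qed
  moreover have "pt v (w \<oplus>\<^bsub>W\<^esub> w') = pt v w \<oplus>\<^bsub>T\<^esub> pt v w'"
    if "v \<in> carrier V" "w \<in> carrier W" "w' \<in> carrier W" for v w w'
  proof -
    have "q (e v (w \<oplus>\<^bsub>W\<^esub> w')) = q (e v w \<oplus>\<^bsub>F\<^esub> e v w')"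
      using that by (intro tensor_coset_eqI) (auto simp: free_gen_pair_closed tensor_relations_def Let_def)
    then show ?thesis using that by (simp add: pure_tensor_def free_gen_pair_closed)
  qed
  moreover have "pt (c \<odot>\<^bsub>V\<^esub> v) w = c \<odot>\<^bsub>T\<^esub> pt v w"
    if "c \<in> carrier K" "v \<in> carrier V" "w \<in> carrier W" for c v w
  proof -
    have "q (e (c \<odot>\<^bsub>V\<^esub> v) w) = q (c \<odot>\<^bsub>F\<^esub> e v w)"
      using that by (intro tensor_coset_eqI) (auto simp: free_gen_pair_closed tensor_relations_def Let_def)
    then show ?thesis using that by (simp add: pure_tensor_def free_gen_pair_closed)
  qed
  moreover have "pt v (c \<odot>\<^bsub>W\<^esub> w) = c \<odot>\<^bsub>T\<^esub> pt v w"
    if "c \<in> carrier K" "v \<in> carrier V" "w \<in> carrier W" for c v w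
  proof -
    have "q (e v (c \<odot>\<^bsub>W\<^esub> w)) = q (c \<odot>\<^bsub>F\<^esub> e v w)"
      using that by (intro tensor_coset_eqI) (auto simp: free_gen_pair_closed tensor_relations_def Let_def)
    then show ?thesis using that by (simp add: pure_tensor_def free_gen_pair_closed)
  qed
  moreover have "pt v w \<in> carrier T" if "v \<in> carrier V" "w \<in> carrier W" for v w
    using that by (simp add: pure_tensor_def free_gen_pair_closed)
  ultimately show ?thesis
    unfolding bilinear_map_def by (auto intro!: linear_mapI V W tensor_vectorspace)
qed

lemmas pure_tensor_closed = bilinear_mapD(3)[OF pure_tensor_bilinear]

section \<open>Generation by pure tensors and the universal property\<close>

lemma tensor_coset_surj:
  assumes "t \<in> carrier T"
  obtains f where "f \<in> carrier F" "t = q f"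
  using assms by (auto simp: tensor_product_def quotient_module_carrier)

lemma tensor_induct [consumes 1, case_names pure add smult]:
  assumes t: "t \<in> carrier T"
    and pure: "\<And>v w. v \<in> carrier V \<Longrightarrow> w \<in> carrier W \<Longrightarrow> P (pt v w)"
    and add: "\<And>t u. t \<in> carrier T \<Longrightarrow> u \<in> carrier T \<Longrightarrow> P t \<Longrightarrow> P u \<Longrightarrow> P (t \<oplus>\<^bsub>T\<^esub> u)"
    and smult: "\<And>c t. c \<in> carrier K \<Longrightarrow> t \<in> carrier T \<Longrightarrow> P t \<Longrightarrow> P (c \<odot>\<^bsub>T\<^esub> t)"
  shows "P t"
proof -
  obtain f where f: "f \<in> carrier F" and t: "t = q f"
    using t by (rule tensor_coset_surj)
  have "P (q f)"
    using V.field_axioms f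
  proof (induction f rule: free_module_induct)
    \<comment> \<open>The zero tensor is reached as zero times a pure tensor, which keeps the rule
      to three cases.\<close>
    case zero
    have "P (\<zero>\<^bsub>K\<^esub> \<odot>\<^bsub>T\<^esub> pt \<zero>\<^bsub>V\<^esub> \<zero>\<^bsub>W\<^esub>)"
      by (intro assms pure_tensor_closed) auto
    then show ?case by (simp add: pure_tensor_closed)
  next
    case (gen s)
    then show ?case using assms(2)[of "fst s" "snd s"] by (auto simp: pure_tensor_def)
  next
    case (add f g)
    then show ?case using assms(3)[of "q f" "q g"] by simp
  next
    case (smult c f)
    then show ?case using assms(4)[of c "q f"] by simp
  qed
  then show ?thesis by (simp add: t)
qed

lemma tensor_linear_eqI:
  assumes "linear_map K T Z f" "linear_map K T Z g" and t: "t \<in> carrier T"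
    and "\<And>v w. v \<in> carrier V \<Longrightarrow> w \<in> carrier W \<Longrightarrow> f (pt v w) = g (pt v w)"
  shows "f t = g t"
  using t by (induction t rule: tensor_induct)
    (simp_all add: assms(4) linear_mapD[OF assms(1)] linear_mapD[OF assms(2)])

text \<open>The existence half of the universal property: the linear extension of \<phi> to the free
  module kills the relations, hence their span, and so descends to cosets.\<close>

lemma tensor_lift_exists:
  assumes \<phi>: "bilinear_map K V W Z \<phi>"
  shows "\<exists>h. linear_map K T Z h \<and> (\<forall>v\<in>carrier V. \<forall>w\<in>carrier W. h (pt v w) = \<phi> v w)"
proof -
  have Z: "vectorspace K Z"
    using bilinear_mapD(1)[OF \<phi> W.M.zero_closed] by (rule linear_mapD(2))
  interpret Z: vectorspace K Z by (rule Z)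
  have \<phi>_closed: "case_prod \<phi> s \<in> carrier Z" if "s \<in> S" for s
    using that bilinear_mapD(3)[OF \<phi>] by auto
  define L where "L = free_lift K S Z (case_prod \<phi>)"
  have L_linear: "linear_map K F Z L"
    unfolding L_def by (rule free_lift_linear[OF Z \<phi>_closed])
  interpret L: linear_map K F Z L by (rule L_linear)
  have Le: "L (e v w) = \<phi> v w" if "v \<in> carrier V" "w \<in> carrier W" for v w
    unfolding L_def using free_lift_gen[OF Z \<phi>_closed, where s = "(v, w)"] that by simp
  note linear = linear_mapD[OF bilinear_mapD(1)[OF \<phi>]] linear_mapD[OF bilinear_mapD(2)[OF \<phi>]]
  \<comment> \<open>Bilinearity of \<phi> says exactly that \<open>L\<close> vanishes on each
    relation; the kernel is a submodule and so contains the span as well.\<close>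
  have "tensor_relations K V W \<subseteq> L.ker"
    by (rule tensor_relations_subsetI)
      (simp_all add: L.ker_def Le free_gen_pair_closed linear F.M.minus_closed)
  then have kernel: "tensor_kernel K V W \<subseteq> L.ker"
    unfolding tensor_kernel_def using L.ker_is_submodule by (rule F.span_is_subset)
  have L_cong: "L f = L g" if "f \<in> carrier F" "g \<in> carrier F" "q f = q g" for f g
    using that kernel L.T_im[of f] L.T_im[of g] by (auto simp: tensor_coset_eq_iff L.ker_def)
  \<comment> \<open>Any representative of the coset will do, since by \<open>L_cong\<close> the
    value of \<open>L\<close> depends on the coset only.\<close>
  define h where "h t = L (SOME f. f \<in> carrier F \<and> q f = t)" for t
  have h: "h (q f) = L f" if "f \<in> carrier F" for f
  proof -
    have "(SOME g. g \<in> carrier F \<and> q g = q f) \<in> carrier F \<and> q (SOME g. g \<in> carrier F \<and> q g = q f) = q f"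
      using that by (intro someI[of "\<lambda>g. g \<in> carrier F \<and> q g = q f"]) simp
    then show ?thesis unfolding h_def using that by (intro L_cong) auto
  qed
  have "linear_map K T Z h"
    by (rule linear_mapI[OF tensor_vectorspace Z])
      (auto elim!: tensor_coset_surj simp: h q.T_add[symmetric] q.T_smult[symmetric]
        simp del: q.T_add q.T_smult)
  moreover have "h (pt v w) = \<phi> v w" if "v \<in> carrier V" "w \<in> carrier W" for v w
    using that by (simp add: pure_tensor_def h Le free_gen_pair_closed)
  ultimately show ?thesis by (intro exI[of _ h]) simp
qed

lemma map2_pure_tensor_tuples:
  "as \<in> tuples n V \<Longrightarrow> xs \<in> tuples n W \<Longrightarrow> map2 pt as xs \<in> tuples n T"
  by (auto simp: tuples_def set_zip subset_iff intro!: pure_tensor_closed)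

text \<open>The rule \<open>tensor_induct\<close> is applied to one entry at a time. The cases vary
  a single entry, which is the form in which multilinearity is available.\<close>

lemma tensor_tuple_induct [consumes 1, case_names pure add smult]:
  assumes ts: "ts \<in> tuples n T"
    and pure: "\<And>as xs. as \<in> tuples n V \<Longrightarrow> xs \<in> tuples n W \<Longrightarrow> P (map2 pt as xs)"
    and add: "\<And>ts i t u. ts \<in> tuples n T \<Longrightarrow> i < n \<Longrightarrow> t \<in> carrier T \<Longrightarrow> u \<in> carrier T \<Longrightarrow>
      P (ts[i := t]) \<Longrightarrow> P (ts[i := u]) \<Longrightarrow> P (ts[i := t \<oplus>\<^bsub>T\<^esub> u])"
    and smult: "\<And>ts i c t. ts \<in> tuples n T \<Longrightarrow> i < n \<Longrightarrow> c \<in> carrier K \<Longrightarrow> t \<in> carrier T \<Longrightarrow>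
      P (ts[i := t]) \<Longrightarrow> P (ts[i := c \<odot>\<^bsub>T\<^esub> t])"
  shows "P ts"
proof -
  \<comment> \<open>The first \<open>k\<close> entries are arbitrary and the remaining ones pure:
    \<open>k = 0\<close> is the case of pure entries only, \<open>k = n\<close> is the
    claim.\<close>
  have "\<forall>ts\<in>tuples n T. (\<forall>i. k \<le> i \<and> i < n \<longrightarrow> (\<exists>v\<in>carrier V. \<exists>w\<in>carrier W. ts ! i = pt v w)) \<longrightarrow> P ts"
    if "k \<le> n" for k
    using that
  proof (induction k)
    case 0
    show ?case
    proof (intro ballI impI)
      fix ts assume ts: "ts \<in> tuples n T"
        and "\<forall>i. 0 \<le> i \<and> i < n \<longrightarrow> (\<exists>v\<in>carrier V. \<exists>w\<in>carrier W. ts ! i = pt v w)"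
      then have "\<forall>i. i < n \<longrightarrow> (\<exists>v. v \<in> carrier V \<and> (\<exists>w. w \<in> carrier W \<and> ts ! i = pt v w))"
        by (simp add: Bex_def)
      then obtain a x where ax: "\<And>i. i < n \<Longrightarrow> a i \<in> carrier V \<and> x i \<in> carrier W \<and> ts ! i = pt (a i) (x i)"
        by metis
      have "ts = map2 pt (map a [0..<n]) (map x [0..<n])"
        using ts ax by (intro nth_equalityI) (auto simp: tuples_def)
      also have "P \<dots>" using ax by (intro pure) (auto simp: tuples_map_upt)
      finally show "P ts" .
    qed
  next
    case (Suc k)
    show ?case
    proof (intro ballI impI)
      fix ts assume ts: "ts \<in> tuples n T"
        and pu: "\<forall>i. Suc k \<le> i \<and> i < n \<longrightarrow> (\<exists>v\<in>carrier V. \<exists>w\<in>carrier W. ts ! i = pt v w)"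
      have k: "k < n" using Suc.prems by simp
      \<comment> \<open>Generalizing entry \<open>k\<close> to any \<open>t\<close> permits
        induction on it; for pure \<open>t\<close> one more entry is pure and the hypothesis for
        \<open>k\<close> applies.\<close>
      have "P (ts[k := t])" if "t \<in> carrier T" for t
        using that
      proof (induction t rule: tensor_induct)
        case (pure v w)
        have "ts[k := pt v w] \<in> tuples n T" using ts pure by (intro tuples_update pure_tensor_closed)
        moreover have "\<forall>i. k \<le> i \<and> i < n \<longrightarrow> (\<exists>v'\<in>carrier V. \<exists>w'\<in>carrier W. ts[k := pt v w] ! i = pt v' w')"
        proof (intro allI impI)
          fix i assume i: "k \<le> i \<and> i < n"
          show "\<exists>v'\<in>carrier V. \<exists>w'\<in>carrier W. ts[k := pt v w] ! i = pt v' w'"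
          proof (cases "i = k")
            case True
            then show ?thesis using pure ts i by (auto simp: tuples_def)
          next
            case False
            then show ?thesis using pu i by simp
          qed
        qed
        ultimately show ?case using Suc by auto
      next
        case (add t u)
        then show ?case using assms(3)[OF ts k] by blast
      next
        case (smult c t)
        then show ?case using assms(4)[OF ts k] by blast
      qed
      from this[OF tuples_nth[OF ts k]] show "P ts" by simp
    qed
  qed
  from this[of n] show ?thesis using ts by auto
qed

text \<open>The uniqueness half of the universal property in arity \<open>n\<close>; it is also the
  means of proving identities on \<open>T\<close>.\<close>

lemma tensor_multilinear_eqI:
  assumes f: "multilinear_map K n T Z f" and g: "multilinear_map K n T Z g"
    and ts: "ts \<in> tuples n T"
    and eq: "\<And>as xs. as \<in> tuples n V \<Longrightarrow> xs \<in> tuples n W \<Longrightarrow> f (map2 pt as xs) = g (map2 pt as xs)"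
  shows "f ts = g ts"
  using ts
proof (induction ts rule: tensor_tuple_induct)
  case (pure as xs)
  then show ?case by (rule eq)
qed (use f g in \<open>simp_all add: multilinear_map_def\<close>)

end

section \<open>Multilinear extension from pure tensors\<close>

lemma multilinear_map_plus:
  assumes f: "multilinear_map K n V W f" and g: "multilinear_map K n V W g"
    and V: "vectorspace K V" and W: "vectorspace K W"
  shows "multilinear_map K n V W (\<lambda>xs. f xs \<oplus>\<^bsub>W\<^esub> g xs)"
proof -
  interpret W: vectorspace K W by (rule W)
  show ?thesis
    by (rule multilinear_mapI)
      (auto intro!: linear_map_plus multilinear_map_slot[OF f V W] multilinear_map_slot[OF g V W]
        multilinear_map_closed[OF f] multilinear_map_closed[OF g])
qed

lemma multilinear_map_scale:
  assumes f: "multilinear_map K n V W f" and c: "c \<in> carrier K"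
    and V: "vectorspace K V" and W: "vectorspace K W"
  shows "multilinear_map K n V W (\<lambda>xs. c \<odot>\<^bsub>W\<^esub> f xs)"
proof -
  interpret W: vectorspace K W by (rule W)
  show ?thesis
    by (rule multilinear_mapI)
      (auto intro!: linear_map_scale multilinear_map_slot[OF f V W] multilinear_map_closed[OF f] c)
qed

text \<open>Makes the scalars a target space, so that bilinear forms become bilinear maps and fall
  under the universal property.\<close>

definition self_module :: "('k, 'm) ring_scheme \<Rightarrow> ('k, 'k) module" where
  "self_module K = \<lparr>carrier = carrier K, monoid.mult = (\<otimes>\<^bsub>K\<^esub>), one = \<one>\<^bsub>K\<^esub>, zero = \<zero>\<^bsub>K\<^esub>,
     add = (\<oplus>\<^bsub>K\<^esub>), smult = (\<otimes>\<^bsub>K\<^esub>)\<rparr>"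

lemma self_module_simps [simp]:
  "carrier (self_module K) = carrier K"
  "\<zero>\<^bsub>self_module K\<^esub> = \<zero>\<^bsub>K\<^esub>"
  "a \<oplus>\<^bsub>self_module K\<^esub> b = a \<oplus>\<^bsub>K\<^esub> b"
  "a \<odot>\<^bsub>self_module K\<^esub> b = a \<otimes>\<^bsub>K\<^esub> b"
  by (simp_all add: self_module_def)

lemma self_module_vectorspace:
  assumes "field K"
  shows "vectorspace K (self_module K)"
proof -
  interpret K: field K by fact
  show ?thesis
  proof (rule vs_criteria[OF assms])
    show "\<forall>v\<in>carrier (self_module K). \<exists>w\<in>carrier (self_module K).
        v \<oplus>\<^bsub>self_module K\<^esub> w = \<zero>\<^bsub>self_module K\<^esub>"
      using K.r_neg K.a_inv_closed by (simp only: self_module_simps) blast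
  qed (simp_all add: K.a_ac K.m_assoc K.l_distr K.r_distr)
qed

lemma bilinear_form_iff:
  assumes "vectorspace K V"
  shows "bilinear_form K V B \<longleftrightarrow> bilinear_map K V V (self_module K) B"
proof -
  interpret V: vectorspace K V by fact
  note Z = self_module_vectorspace[OF V.field_axioms]
  show ?thesis
  proof
    assume "bilinear_form K V B"
    then show "bilinear_map K V V (self_module K) B"
      unfolding bilinear_map_def bilinear_form_def
      by (intro conjI ballI linear_mapI assms Z) (simp_all only: self_module_simps)
  next
    assume B: "bilinear_map K V V (self_module K) B"
    note B1 = linear_mapD[OF bilinear_mapD(1)[OF B]] and B2 = linear_mapD[OF bilinear_mapD(2)[OF B]]
    show "bilinear_form K V B"
      unfolding bilinear_form_def by (auto simp: B1[simplified] B2[simplified])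
  qed
qed

context tensor_factors
begin

lemma zip_tuples:
  assumes "as \<in> tuples n V" "xs \<in> tuples n W"
  shows "length (zip as xs) = n" "set (zip as xs) \<subseteq> S"
    and "map fst (zip as xs) = as" "map snd (zip as xs) = xs"
  using assms by (auto simp: tuples_def dest: set_zip_leftD set_zip_rightD)

text \<open>Recursion on the arity. With the first pair \<open>s\<close> fixed, the other slots lift
  to \<open>H s\<close>; with the tensors \<open>ts\<close> in those slots fixed,
  \<open>H (v, w) ts\<close> is bilinear in \<open>v\<close> and \<open>w\<close> and lifts through
  the first slot to \<open>L ts\<close>. Arguments are lists of pairs so that one tensor slot
  corresponds to one entry.\<close>

lemma tensor_multilinear_lift_exists:
  fixes Z :: "('k, 'z, 'r) module_scheme" and \<phi> :: "('a \<times> 'b) list \<Rightarrow> 'z"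
  assumes Z: "vectorspace K Z"
    and closed: "\<And>ps. length ps = n \<Longrightarrow> set ps \<subseteq> S \<Longrightarrow> \<phi> ps \<in> carrier Z"
    and slot: "\<And>ps i. length ps = n \<Longrightarrow> set ps \<subseteq> S \<Longrightarrow> i < n \<Longrightarrow>
      bilinear_map K V W Z (\<lambda>v w. \<phi> (ps[i := (v, w)]))"
  shows "\<exists>h. multilinear_map K n T Z h \<and>
    (\<forall>ps. length ps = n \<longrightarrow> set ps \<subseteq> S \<longrightarrow> h (map (case_prod pt) ps) = \<phi> ps)"
  using closed slot
proof (induction n arbitrary: \<phi>)
  case 0
  then have "multilinear_map K 0 T Z (\<lambda>_. \<phi> [])"
    by (intro multilinear_mapI) auto
  then show ?case by (intro exI[of _ "\<lambda>_. \<phi> []"]) auto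
next
  case (Suc n)
  interpret Z: vectorspace K Z by (rule Z)
  have "\<exists>h. multilinear_map K n T Z h \<and>
      (\<forall>ps. length ps = n \<longrightarrow> set ps \<subseteq> S \<longrightarrow> h (map (case_prod pt) ps) = \<phi> (s # ps))"
    if "s \<in> S" for s
  proof (rule Suc.IH)
    show "\<phi> (s # ps) \<in> carrier Z" if "length ps = n" "set ps \<subseteq> S" for ps
      using that \<open>s \<in> S\<close> by (intro Suc.prems(1)) auto
    show "bilinear_map K V W Z (\<lambda>v w. \<phi> (s # ps[i := (v, w)]))"
      if "length ps = n" "set ps \<subseteq> S" "i < n" for ps i
      using Suc.prems(2)[of "s # ps" "Suc i"] that \<open>s \<in> S\<close> by simp
  qed
  then obtain H where H: "\<And>s. s \<in> S \<Longrightarrow> multilinear_map K n T Z (H s)"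
    and Hp: "\<And>s ps. s \<in> S \<Longrightarrow> length ps = n \<Longrightarrow> set ps \<subseteq> S \<Longrightarrow>
      H s (map (case_prod pt) ps) = \<phi> (s # ps)"
    by metis
  note zip = zip_tuples
  have \<phi>: "bilinear_map K V W Z (\<lambda>v w. \<phi> ((v, w) # ps))"
    if "length ps = n" "set ps \<subseteq> S" for ps
    using Suc.prems(2)[of "(\<zero>\<^bsub>V\<^esub>, \<zero>\<^bsub>W\<^esub>) # ps" 0] that by simp
  note \<phi>1 = linear_mapD[OF bilinear_mapD(1)[OF \<phi>]]
  note \<phi>2 = linear_mapD[OF bilinear_mapD(2)[OF \<phi>]]
  note eqI = tensor_multilinear_eqI
  note plus = multilinear_map_plus[OF H H T.vectorspace_axioms Z]
  note scale = multilinear_map_scale[OF H _ T.vectorspace_axioms Z]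
  \<comment> \<open>\<open>H s\<close> is determined by its values at pure tensors, where it agrees
    with \<phi>; uniqueness thus carries the bilinearity of \<phi> in the first pair over to
    arbitrary \<open>ts\<close>.\<close>
  have bilinear: "bilinear_map K V W Z (\<lambda>v w. H (v, w) ts)" if ts: "ts \<in> tuples n T" for ts
    unfolding bilinear_map_def
  proof (intro conjI ballI linear_mapI V W Z)
    fix v v' w assume v: "v \<in> carrier V" "v' \<in> carrier V" and w: "w \<in> carrier W"
    show "H (v \<oplus>\<^bsub>V\<^esub> v', w) ts = H (v, w) ts \<oplus>\<^bsub>Z\<^esub> H (v', w) ts"
      by (rule eqI[OF H plus ts]) (use v w zip in \<open>auto simp: Hp \<phi>1\<close>)
  next
    fix c v w assume c: "c \<in> carrier K" and v: "v \<in> carrier V" and w: "w \<in> carrier W"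
    show "H (c \<odot>\<^bsub>V\<^esub> v, w) ts = c \<odot>\<^bsub>Z\<^esub> H (v, w) ts"
      by (rule eqI[OF H scale ts]) (use c v w zip in \<open>auto simp: Hp \<phi>1\<close>)
    show "H (v, c \<odot>\<^bsub>W\<^esub> w) ts = c \<odot>\<^bsub>Z\<^esub> H (v, w) ts"
      by (rule eqI[OF H scale ts]) (use c v w zip in \<open>auto simp: Hp \<phi>2\<close>)
  next
    fix v w w' assume v: "v \<in> carrier V" and w: "w \<in> carrier W" "w' \<in> carrier W"
    show "H (v, w \<oplus>\<^bsub>W\<^esub> w') ts = H (v, w) ts \<oplus>\<^bsub>Z\<^esub> H (v, w') ts"
      by (rule eqI[OF H plus ts]) (use v w zip in \<open>auto simp: Hp \<phi>2\<close>)
  qed (use multilinear_map_closed[OF H ts] in auto)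
  have "\<exists>L. linear_map K T Z L \<and> (\<forall>v\<in>carrier V. \<forall>w\<in>carrier W. L (pt v w) = H (v, w) ts)"
    if "ts \<in> tuples n T" for ts
    by (rule tensor_lift_exists[OF bilinear[OF that]])
  then have "\<exists>L. \<forall>ts\<in>tuples n T. linear_map K T Z (L ts) \<and>
      (\<forall>v\<in>carrier V. \<forall>w\<in>carrier W. L ts (pt v w) = H (v, w) ts)"
    by (intro bchoice ballI)
  then obtain L where "\<forall>ts\<in>tuples n T. linear_map K T Z (L ts) \<and>
      (\<forall>v\<in>carrier V. \<forall>w\<in>carrier W. L ts (pt v w) = H (v, w) ts)" ..
  then have L: "\<And>ts. ts \<in> tuples n T \<Longrightarrow> linear_map K T Z (L ts)"
    and Lp: "\<And>ts v w. ts \<in> tuples n T \<Longrightarrow> v \<in> carrier V \<Longrightarrow> w \<in> carrier W \<Longrightarrow>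
      L ts (pt v w) = H (v, w) ts"
    by simp_all
  note L' = linear_mapD[OF L]
  \<comment> \<open>\<open>L ts\<close> was chosen separately for each \<open>ts\<close>, so
    linearity in the entries of \<open>ts\<close> needs an argument. At a pure tensor it is that of
    \<open>H\<close>, and it survives sums and scaling of \<open>t\<close>.\<close>
  have L_slot: "linear_map K T Z (\<lambda>u. L (ts[j := u]) t)"
    if ts: "ts \<in> tuples n T" and j: "j < n" and t: "t \<in> carrier T" for ts j t
    using t
  proof (induction t rule: tensor_induct)
    case (pure v w)
    have "linear_map K T Z (\<lambda>u. H (v, w) (ts[j := u]))"
      using pure by (intro multilinear_map_slot[OF H T.vectorspace_axioms Z ts j]) auto
    then show ?case
      by (rule linear_map_cong[rotated]) (use pure ts in \<open>auto intro!: Lp tuples_update\<close>)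
  next
    case (add t t')
    show ?case
      by (rule linear_map_cong[OF _ linear_map_plus[OF add(3,4)]])
        (use add ts in \<open>auto intro!: L' tuples_update\<close>)
  next
    case (smult c t)
    show ?case
      by (rule linear_map_cong[OF _ linear_map_scale[OF smult(3,1)]])
        (use smult ts in \<open>auto intro!: L' tuples_update\<close>)
  qed
  define h where "h ts = L (tl ts) (hd ts)" for ts
  have "multilinear_map K (Suc n) T Z h"
  proof (rule multilinear_mapI)
    fix us assume "us \<in> tuples (Suc n) T"
    then obtain t ts where us: "us = t # ts" and t: "t \<in> carrier T" and ts: "ts \<in> tuples n T"
      by (cases us) (auto simp: tuples_def)
    show "h us \<in> carrier Z" using t ts by (simp add: us h_def L')
    show "linear_map K T Z (\<lambda>u. h (us[i := u]))" if "i < Suc n" for i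
      using that L[OF ts] L_slot[OF ts _ t] by (cases i) (simp_all add: us h_def)
  qed
  moreover have "h (map (case_prod pt) ps) = \<phi> ps" if ps: "length ps = Suc n" "set ps \<subseteq> S" for ps
  proof -
    obtain v w qs where ps': "ps = (v, w) # qs" "v \<in> carrier V" "w \<in> carrier W"
      "length qs = n" "set qs \<subseteq> S"
      using ps by (cases ps) auto
    then have "map (case_prod pt) qs \<in> tuples n T"
      by (auto simp: tuples_def intro!: pure_tensor_closed)
    then show ?thesis using ps' by (simp add: h_def Lp Hp)
  qed
  ultimately show ?case by blast
qed

section \<open>Existence of the maps, operations and forms on the tensor product\<close>

lemma tensor_map_exists:
  assumes "linear_map K V V f" "linear_map K W W g"
  shows "\<exists>h. is_tensor_map K V W f g h"
proof -
  note pt = bilinear_mapD[OF pure_tensor_bilinear]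
  have "bilinear_map K V W T (\<lambda>v w. pt (f v) (g w))"
    unfolding bilinear_map_def
    using assms linear_map_compose[OF pt(1) assms(1)] linear_map_compose[OF pt(2) assms(2)]
    by (simp add: linear_mapD(3))
  from tensor_lift_exists[OF this] show ?thesis unfolding is_tensor_map_def .
qed

lemma tensor_operation_exists:
  assumes f: "multilinear_map K n V V f" and g: "multilinear_map K n W W g"
  shows "\<exists>h. is_tensor_operation K n V W f g h"
proof -
  note pt = bilinear_mapD[OF pure_tensor_bilinear]
  let ?\<phi> = "\<lambda>ps. pt (f (map fst ps)) (g (map snd ps))"
  have tuples: "map fst ps \<in> tuples n V" "map snd ps \<in> tuples n W"
    if "length ps = n" "set ps \<subseteq> S" for ps
    using that by (auto simp: tuples_def)
  have "\<exists>h. multilinear_map K n T T h \<and>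
    (\<forall>ps. length ps = n \<longrightarrow> set ps \<subseteq> S \<longrightarrow> h (map (case_prod pt) ps) = ?\<phi> ps)"
  proof (rule tensor_multilinear_lift_exists[OF T.vectorspace_axioms])
    show "?\<phi> ps \<in> carrier T" if "length ps = n" "set ps \<subseteq> S" for ps
      using tuples[OF that] by (intro pt(3) multilinear_map_closed[OF f] multilinear_map_closed[OF g])
    show "bilinear_map K V W T (\<lambda>v w. ?\<phi> (ps[i := (v, w)]))"
      if ps: "length ps = n" "set ps \<subseteq> S" and i: "i < n" for ps i
      unfolding bilinear_map_def map_update fst_conv snd_conv
    proof (intro conjI ballI)
      fix w assume "w \<in> carrier W"
      then show "linear_map K V T (\<lambda>v. pt (f ((map fst ps)[i := v])) (g ((map snd ps)[i := w])))"
        by (intro linear_map_compose[OF pt(1)] multilinear_map_slot[OF f V V tuples(1)[OF ps] i]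
            multilinear_map_closed[OF g] tuples_update tuples(2)[OF ps])
    next
      fix v assume "v \<in> carrier V"
      then show "linear_map K W T (\<lambda>w. pt (f ((map fst ps)[i := v])) (g ((map snd ps)[i := w])))"
        by (intro linear_map_compose[OF pt(2)] multilinear_map_slot[OF g W W tuples(2)[OF ps] i]
            multilinear_map_closed[OF f] tuples_update tuples(1)[OF ps])
    qed
  qed
  then obtain h where h: "multilinear_map K n T T h"
    and hp: "\<And>ps. length ps = n \<Longrightarrow> set ps \<subseteq> S \<Longrightarrow> h (map (case_prod pt) ps) = ?\<phi> ps"
    by blast
  have "h (map2 pt as xs) = pt (f as) (g xs)" if "as \<in> tuples n V" "xs \<in> tuples n W" for as xs
    using hp[OF zip_tuples(1,2)[OF that]] zip_tuples(3,4)[OF that] by simp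
  with h show ?thesis by (auto simp: is_tensor_operation_def)
qed

text \<open>The case of arity two with the field as target: each pair of the list collects the two
  components of one argument of the form.\<close>

lemma tensor_form_exists:
  assumes B: "bilinear_form K V B" and B': "bilinear_form K W B'"
  shows "\<exists>C. is_tensor_form K V W B B' C"
proof -
  note T = tensor_vectorspace and Z = self_module_vectorspace[OF V.field_axioms]
  let ?Z = "self_module K"
  note B = bilinear_mapD[OF iffD1[OF bilinear_form_iff[OF V] B]]
  note B' = bilinear_mapD[OF iffD1[OF bilinear_form_iff[OF W] B']]
  let ?\<phi> = "\<lambda>ps. B (fst (ps ! 0)) (fst (ps ! 1)) \<otimes>\<^bsub>K\<^esub> B' (snd (ps ! 0)) (snd (ps ! 1))"
  have mult_left: "linear_map K U ?Z (\<lambda>u. c \<otimes>\<^bsub>K\<^esub> f u)"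
    if "linear_map K U ?Z f" "c \<in> carrier K" for U f c
    using linear_map_scale[OF that] by simp
  have mult_right: "linear_map K U ?Z (\<lambda>u. f u \<otimes>\<^bsub>K\<^esub> c)"
    if "linear_map K U ?Z f" "c \<in> carrier K" for U f c
    by (rule linear_map_cong[OF _ mult_left[OF that]])
      (use linear_mapD(3)[OF that(1)] that(2) in \<open>auto intro!: V.R.m_comm\<close>)
  have "\<exists>h. multilinear_map K 2 T ?Z h \<and>
    (\<forall>ps. length ps = 2 \<longrightarrow> set ps \<subseteq> S \<longrightarrow> h (map (case_prod pt) ps) = ?\<phi> ps)"
  proof (rule tensor_multilinear_lift_exists[OF Z])
    fix ps assume "length ps = 2" "set ps \<subseteq> S"
    then obtain a x b y where ps: "ps = [(a, x), (b, y)]" and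
      mem: "a \<in> carrier V" "b \<in> carrier V" "x \<in> carrier W" "y \<in> carrier W"
      by (auto simp: length_Suc_conv numeral_2_eq_2)
    show "?\<phi> ps \<in> carrier ?Z"
      using B(3) B'(3) mem by (simp add: ps)
    fix i :: nat assume "i < 2"
    then consider "i = 0" | "i = 1" by linarith
    then show "bilinear_map K V W ?Z (\<lambda>v w. ?\<phi> (ps[i := (v, w)]))"
      by cases (use B B' mem in \<open>auto simp: ps bilinear_map_def intro!: mult_left mult_right\<close>)
  qed
  then obtain h where h: "multilinear_map K 2 T ?Z h"
    and hp: "\<And>ps. length ps = 2 \<Longrightarrow> set ps \<subseteq> S \<Longrightarrow> h (map (case_prod pt) ps) = ?\<phi> ps"
    by blast
  \<comment> \<open>The list \<open>[u, u]\<close> supplies the fixed argument in one place; the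
    entry in the other place is overwritten.\<close>
  have "linear_map K T ?Z (\<lambda>t. h [t, u])" "linear_map K T ?Z (\<lambda>t. h [u, t])"
    if "u \<in> carrier T" for u
    using multilinear_map_slot[OF h T Z, of "[u, u]" 0] multilinear_map_slot[OF h T Z, of "[u, u]" 1]
      that by (simp_all add: tuples_def)
  then have "bilinear_form K T (\<lambda>t u. h [t, u])"
    unfolding bilinear_form_iff[OF T] bilinear_map_def by simp
  moreover have "h [pt a x, pt b y] = B a b \<otimes>\<^bsub>K\<^esub> B' x y"
    if "a \<in> carrier V" "b \<in> carrier V" "x \<in> carrier W" "y \<in> carrier W" for a b x y
    using hp[of "[(a, x), (b, y)]"] that by simp
  ultimately show ?thesis unfolding is_tensor_form_def by blast
qed

end

section \<open>Symmetry of the totally Hom-associative product\<close>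

text \<open>Insertion by adjacent swaps: bring the head of \<open>xs\<close> to the front of
  \<open>ys\<close>, then recurse on the tails with that head held fixed. Swaps are assumed only for
  rearrangements of \<open>xs\<close>, since in the application all lists must stay in the
  carrier.\<close>

lemma swap_invariant_imp_mset_invariant:
  assumes "\<And>us a b vs. mset (us @ a # b # vs) = mset xs \<Longrightarrow> f (us @ a # b # vs) = f (us @ b # a # vs)"
    and "mset ys = mset xs"
  shows "f ys = f xs"
  using assms
proof (induction xs arbitrary: f ys)
  case Nil
  then show ?case by simp
next
  case (Cons x xs)
  have move: "f (us @ x # vs) = f (x # us @ vs)" if "mset (us @ x # vs) = mset (x # xs)" for us vs
    using that
  proof (induction us arbitrary: vs rule: rev_induct)
    case Nil
    then show ?case by simp
  next
    case (snoc z us)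
    have "f (us @ z # x # vs) = f (us @ x # z # vs)"
      using snoc.prems by (intro Cons.prems(1)) simp
    also have "\<dots> = f (x # us @ z # vs)"
      using snoc.prems by (intro snoc.IH) simp
    finally show ?case by simp
  qed
  have "x \<in> set ys" using Cons.prems(2) by (metis list.set_intros(1) mset_eq_setD)
  then obtain us vs where ys: "ys = us @ x # vs" by (meson split_list)
  have "f ys = f (x # us @ vs)" using move[of us vs] Cons.prems(2) by (simp add: ys)
  also have "\<dots> = f (x # xs)"
  proof (rule Cons.IH[of "\<lambda>zs. f (x # zs)"])
    show "mset (us @ vs) = mset xs" using Cons.prems(2) by (simp add: ys)
    show "f (x # us' @ a # b # vs') = f (x # us' @ b # a # vs')"
      if "mset (us' @ a # b # vs') = mset xs" for us' a b vs'
      using Cons.prems(1)[of "x # us'" a b vs'] that by simp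
  qed
  finally show ?case .
qed

text \<open>Symmetry in terms of multisets, so that two blocks can be compared without naming the
  permutation between them.\<close>

lemma symmetric_hom_assoc_mset_cong:
  assumes "symmetric_totally_hom_assoc_algebra K n A \<mu> \<eta>"
    and "as \<in> tuples n A" "mset bs = mset as"
  shows "\<mu> bs = \<mu> as"
proof -
  obtain \<sigma> where "\<sigma> permutes {..<length as}" "permute_list \<sigma> as = bs"
    using mset_eq_permutation[OF assms(3)] by blast
  then show ?thesis
    using assms(1,2) by (auto simp: symmetric_totally_hom_assoc_algebra_def tuples_def)
qed

lemma hom_assoc_product_independent:
  assumes "symmetric_totally_hom_assoc_algebra K n A \<mu> \<eta>"
    and "as \<in> tuples (2 * n - 1) A" "i < n" "j < n"
  shows "hom_assoc_product n \<mu> \<eta> i as = hom_assoc_product n \<mu> \<eta> j as"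
  using assms unfolding symmetric_totally_hom_assoc_algebra_def by blast

text \<open>Two adjacent entries always lie in a common inner block of length \<open>n \<ge> 2\<close>, and by total
  Hom-associativity the inner product may be moved to that block.\<close>

lemma hom_assoc_product_swap:
  assumes A: "symmetric_totally_hom_assoc_algebra K n A \<mu> \<eta>" and n: "n \<ge> 2" and i: "i < n"
    and ab: "us @ a # b # vs \<in> tuples (2 * n - 1) A"
  shows "hom_assoc_product n \<mu> \<eta> i (us @ a # b # vs) = hom_assoc_product n \<mu> \<eta> i (us @ b # a # vs)"
proof -
  let ?as = "us @ a # b # vs" and ?bs = "us @ b # a # vs"
  \<comment> \<open>The inner block starts at \<open>a\<close> itself, unless this exceeds the last
    admissible start \<open>n - 1\<close>; then the block is the final one and reaches the end of
    the list. In both cases it covers \<open>a\<close> and \<open>b\<close>.\<close>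
  define k where "k = min (length us) (n - 1)"
  have len: "length us + length vs + 2 = 2 * n - 1" using ab by (auto simp: tuples_def)
  have k: "k < n" "k \<le> length us" "length us + 2 \<le> k + n" using n len by (auto simp: k_def)
  have ba: "?bs \<in> tuples (2 * n - 1) A" using ab by (auto simp: tuples_def)
  have move: "hom_assoc_product n \<mu> \<eta> i cs = hom_assoc_product n \<mu> \<eta> k cs"
    if "cs \<in> tuples (2 * n - 1) A" for cs
    using that by (rule hom_assoc_product_independent[OF A _ i k(1)])
  have "take n (drop k ?as) \<in> tuples n A"
    unfolding tuples_def
  proof (intro CollectI conjI)
    show "length (take n (drop k ?as)) = n" using k len by auto
    have "set (take n (drop k ?as)) \<subseteq> set ?as"
      by (rule order_trans[OF set_take_subset set_drop_subset])
    also have "\<dots> \<subseteq> carrier A" using ab by (simp only: tuples_def mem_Collect_eq)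
    finally show "set (take n (drop k ?as)) \<subseteq> carrier A" .
  qed
  moreover have "mset (take n (drop k ?bs)) = mset (take n (drop k ?as))"
  proof -
    \<comment> \<open>\<open>m\<close> is the number of block entries after \<open>b\<close>;
      exposing the two successors lets \<open>take\<close> pass over both swapped entries.\<close>
    obtain m where "k + n = length us + 2 + m" using k(3) le_Suc_ex by blast
    then have m: "n - (length us - k) = Suc (Suc m)" using k(2) by linarith
    show ?thesis using k(2) by (simp add: m)
  qed
  ultimately have block: "\<mu> (take n (drop k ?bs)) = \<mu> (take n (drop k ?as))"
    by (rule symmetric_hom_assoc_mset_cong[OF A])
  \<comment> \<open>The swap affects positions \<open>length us\<close> and
    \<open>length us + 1\<close> only, and the outer slots read positions outside the block.\<close>
  have nth: "?bs ! j = ?as ! j" if "j < length us \<or> j \<ge> length us + 2" for j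
  proof (cases "j < length us")
    case False
    then have "length us + 2 \<le> j" using that by simp
    then obtain m where "j = length us + 2 + m" using le_Suc_ex by blast
    then show ?thesis by (simp add: nth_append)
  qed (simp add: nth_append)
  have "hom_assoc_product n \<mu> \<eta> k ?bs = hom_assoc_product n \<mu> \<eta> k ?as"
    unfolding hom_assoc_product_def block
    by (intro arg_cong[of _ _ \<mu>] map_cong refl) (use k in \<open>auto intro!: arg_cong[of _ _ "\<eta> _"] nth\<close>)
  then show ?thesis using move[OF ab] move[OF ba] by simp
qed

lemma hom_assoc_product_mset_cong:
  assumes A: "symmetric_totally_hom_assoc_algebra K n A \<mu> \<eta>" and n: "n \<ge> 2"
    and i: "i < n" and j: "j < n"
    and as: "as \<in> tuples (2 * n - 1) A" and bs: "mset bs = mset as"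
  shows "hom_assoc_product n \<mu> \<eta> i bs = hom_assoc_product n \<mu> \<eta> j as"
proof -
  have "hom_assoc_product n \<mu> \<eta> i bs = hom_assoc_product n \<mu> \<eta> i as"
  proof (rule swap_invariant_imp_mset_invariant[OF _ bs])
    fix us a b vs assume "mset (us @ a # b # vs) = mset as"
    from mset_eq_length[OF this] mset_eq_setD[OF this] as
    have "us @ a # b # vs \<in> tuples (2 * n - 1) A" by (simp add: tuples_def)
    then show "hom_assoc_product n \<mu> \<eta> i (us @ a # b # vs) = hom_assoc_product n \<mu> \<eta> i (us @ b # a # vs)"
      by (rule hom_assoc_product_swap[OF A n i])
  qed
  also have "\<dots> = hom_assoc_product n \<mu> \<eta> j as"
    by (rule hom_assoc_product_independent[OF A as i j])
  finally show ?thesis .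
qed

section \<open>The Hom-Nambu identity on the tensor product\<close>

text \<open>The two sides of the identity, as functions of the single tuple
  \<open>x\<^sub>1, \<dots>, x\<^sub>n\<^sub>-\<^sub>1, y\<^sub>1, \<dots>, y\<^sub>n\<close> so that both become multilinear maps of arity \<open>2n - 1\<close>.\<close>

definition nambu_left :: "nat \<Rightarrow> ('v list \<Rightarrow> 'v) \<Rightarrow> (nat \<Rightarrow> 'v \<Rightarrow> 'v) \<Rightarrow> 'v list \<Rightarrow> 'v" where
  "nambu_left n br \<alpha> zs =
     br (map (\<lambda>j. if j < n - 1 then \<alpha> j (zs ! j) else br (drop (n - 1) zs)) [0..<n])"

definition nambu_right :: "nat \<Rightarrow> ('v list \<Rightarrow> 'v) \<Rightarrow> (nat \<Rightarrow> 'v \<Rightarrow> 'v) \<Rightarrow> nat \<Rightarrow> 'v list \<Rightarrow> 'v" where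
  "nambu_right n br \<alpha> i zs =
     br (map (\<lambda>j. if j < i then \<alpha> j (zs ! (n - 1 + j))
                  else if j = i then br (take (n - 1) zs @ [zs ! (n - 1 + i)])
                  else \<alpha> (j - 1) (zs ! (n - 1 + j))) [0..<n])"

text \<open>A tuple of length \<open>2n - 1\<close> splits uniquely after \<open>n - 1\<close>
  entries into \<open>xs\<close> and \<open>ys\<close>, so the identity compares two functions of a
  single tuple.\<close>

lemma hom_nambu_algebra_iff:
  assumes "n \<ge> 1"
  shows "hom_nambu_algebra K n N br \<alpha> \<longleftrightarrow>
    vectorspace K N \<and> multilinear_map K n N N br \<and> (\<forall>i < n - 1. linear_map K N N (\<alpha> i)) \<and>
    (\<forall>zs \<in> tuples (2 * n - 1) N.
       nambu_left n br \<alpha> zs = (\<Oplus>\<^bsub>N\<^esub>i\<in>{..<n}. nambu_right n br \<alpha> i zs))"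
proof -
  have left: "nambu_left n br \<alpha> (xs @ ys) = br (map (\<lambda>j. \<alpha> j (xs ! j)) [0..<n - 1] @ [br ys])"
    if "length xs = n - 1" for xs ys
  proof -
    have "[0..<n] = [0..<n - 1] @ [n - 1]"
      using assms by (metis One_nat_def Suc_pred less_eq_Suc_le upt_Suc_append zero_le)
    then show ?thesis
      using that unfolding nambu_left_def by (auto simp: nth_append intro!: arg_cong[of _ _ br])
  qed
  have right: "nambu_right n br \<alpha> i (xs @ ys) =
      br (map (\<lambda>j. if j < i then \<alpha> j (ys ! j) else if j = i then br (xs @ [ys ! i])
                   else \<alpha> (j - 1) (ys ! j)) [0..<n])"
    if "length xs = n - 1" for xs ys i
    unfolding nambu_right_def nth_append using that by (simp add: nth_append cong: if_cong)
  have split: "(\<forall>zs \<in> tuples (2 * n - 1) N. P zs) \<longleftrightarrow>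
      (\<forall>xs \<in> tuples (n - 1) N. \<forall>ys \<in> tuples n N. P (xs @ ys))" for P
  proof (intro iffI ballI)
    fix zs assume P: "\<forall>xs \<in> tuples (n - 1) N. \<forall>ys \<in> tuples n N. P (xs @ ys)"
      and zs: "zs \<in> tuples (2 * n - 1) N"
    have "take (n - 1) zs \<in> tuples (n - 1) N" "drop (n - 1) zs \<in> tuples n N"
      using zs assms by (auto simp: tuples_def dest: in_set_takeD in_set_dropD)
    then have "P (take (n - 1) zs @ drop (n - 1) zs)" using P by blast
    then show "P zs" by simp
  qed (use assms in \<open>auto simp: tuples_def\<close>)
  show ?thesis
    unfolding hom_nambu_algebra_def split
    by (simp add: left right tuples_def cong: conj_cong ball_cong)
qed

text \<open>Read in order of occurrence, the arguments of either side form a nested product of a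
  rearrangement of \<open>cs\<close>: the left side has its inner block in the last place
  \<open>n - 1\<close>, the \<open>i\<close>-th summand has it in place \<open>i\<close>. Every
  single summand therefore equals the left side.\<close>

lemma symmetric_hom_assoc_nambu:
  assumes A: "symmetric_totally_hom_assoc_algebra K n A \<mu> \<eta>" and n: "n \<ge> 2" and i: "i < n"
    and cs: "cs \<in> tuples (2 * n - 1) A"
  shows "nambu_right n \<mu> \<eta> i cs = nambu_left n \<mu> \<eta> cs"
proof -
  define as bs where "as = take (n - 1) cs" and "bs = drop (n - 1) cs"
  have len: "length as = n - 1" "length bs = n" and split: "cs = as @ bs"
    using cs n by (auto simp: as_def bs_def tuples_def)
  have "nambu_left n \<mu> \<eta> cs = hom_assoc_product n \<mu> \<eta> (n - 1) cs"
    unfolding nambu_left_def hom_assoc_product_def using len n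
    by (intro arg_cong[of _ _ \<mu>] map_cong) (auto simp: split)
  \<comment> \<open>The rearrangement puts the block \<open>as\<close> just before
    \<open>bs ! i\<close>, so that the \<open>n\<close> entries from position \<open>i\<close> on
    are those of the inner bracket.\<close>
  moreover have "nambu_right n \<mu> \<eta> i cs = hom_assoc_product n \<mu> \<eta> i (take i bs @ as @ drop i bs)"
  proof -
    have "take n (drop i (take i bs @ as @ drop i bs)) = as @ [bs ! i]"
      using len i n by (simp add: take_Suc_conv_app_nth Cons_nth_drop_Suc[symmetric])
    moreover have "(take i bs @ as @ drop i bs) ! j = bs ! j" if "j < i" for j
      using that len i by (simp add: nth_append)
    \<comment> \<open>Entries of \<open>bs\<close> after the insertion point are shifted by the
      \<open>n - 1\<close> entries of \<open>as\<close>, which gives the position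
      \<open>j - 1 + n\<close>.\<close>
    moreover have "(take i bs @ as @ drop i bs) ! (j - 1 + n) = bs ! j" if "j > i" "j < n" for j
    proof -
      have "\<exists>m. j = Suc (i + m)" using that(1) by (rule less_imp_Suc_add)
      then obtain m where "j = Suc (i + m)" ..
      then show ?thesis using that len i n by (auto simp: nth_append)
    qed
    moreover have "cs ! (n - 1 + j) = bs ! j" for j
      using len by (simp add: split nth_append)
    ultimately show ?thesis
      unfolding nambu_right_def hom_assoc_product_def as_def[symmetric]
      by (intro arg_cong[of _ _ \<mu>] map_cong refl) simp
  qed
  moreover have "mset (take i bs @ as @ drop i bs) = mset cs"
    by (metis append_take_drop_id mset_append split union_commute union_lcomm)
  ultimately show ?thesis
    using hom_assoc_product_mset_cong[OF A n i _ cs, of "n - 1"] n by simp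
qed

section \<open>Multilinearity of both sides in \<open>2n - 1\<close> arguments\<close>

lemma nambu_tuples:
  assumes "zs \<in> tuples (2 * n - 1) N" and "n \<ge> 1"
  shows "drop (n - 1) zs \<in> tuples n N"
    and "i < n \<Longrightarrow> take (n - 1) zs @ [zs ! (n - 1 + i)] \<in> tuples n N"
  using assms set_drop_subset[of "n - 1" zs] set_take_subset[of "n - 1" zs]
    tuples_nth[OF assms(1), of "n - 1 + i"]
  by (simp_all add: tuples_def min_def) (auto simp: min_def)

lemma nambu_left_multilinear:
  assumes N: "vectorspace K N" and br: "multilinear_map K n N N br"
    and \<alpha>: "\<And>i. i < n - 1 \<Longrightarrow> linear_map K N N (\<alpha> i)" and n: "n \<ge> 1"
  shows "multilinear_map K (2 * n - 1) N N (nambu_left n br \<alpha>)"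
proof (rule multilinear_mapI)
  fix zs assume zs: "zs \<in> tuples (2 * n - 1) N"
  have len: "length zs = 2 * n - 1" using zs by (simp add: tuples_def)
  have closed: "\<alpha> j (zs ! j) \<in> carrier N" if "j < n - 1" for j
    using linear_mapD(3)[OF \<alpha>[OF that]] tuples_nth[OF zs] that by simp
  have closed': "br (drop (n - 1) zs) \<in> carrier N"
    by (rule multilinear_map_closed[OF br nambu_tuples(1)[OF zs n]])
  show "nambu_left n br \<alpha> zs \<in> carrier N"
    unfolding nambu_left_def
    by (rule multilinear_map_closed[OF br]) (simp add: tuples_map_upt closed closed' del: One_nat_def)
  fix p assume p: "p < 2 * n - 1"
  \<comment> \<open>An argument with \<open>p < n - 1\<close> sits in outer slot \<open>p\<close>.
    Any other one sits in the inner bracket, hence in outer slot \<open>n - 1\<close>, at inner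
    position \<open>p - (n - 1)\<close>.\<close>
  let ?g = "\<lambda>v j. if j < n - 1 then \<alpha> j (zs[p := v] ! j) else br (drop (n - 1) (zs[p := v]))"
  let ?c = "\<lambda>j. if j < n - 1 then \<alpha> j (zs ! j) else br (drop (n - 1) zs)"
  show "linear_map K N N (\<lambda>v. nambu_left n br \<alpha> (zs[p := v]))"
    unfolding nambu_left_def
  proof (rule linear_map_slot_compose[OF br N, where g = ?g and c = ?c
        and j = "if p < n - 1 then p else n - 1"])
    show "linear_map K N N (\<lambda>v. ?g v (if p < n - 1 then p else n - 1))"
    proof (cases "p < n - 1")
      case True
      then show ?thesis using \<alpha>[OF True] len by simp
    next
      case False
      then show ?thesis
        using multilinear_map_slot[OF br N N nambu_tuples(1)[OF zs n], of "p - (n - 1)"] p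
        by (simp add: drop_update_swap)
    qed
    show "?g v k = ?c k" if "k < n" "k \<noteq> (if p < n - 1 then p else n - 1)" for k v
      using that by (auto simp: drop_update_cancel split: if_splits)
  qed (use n closed closed' in auto)
qed

lemma nambu_right_multilinear:
  assumes N: "vectorspace K N" and br: "multilinear_map K n N N br"
    and \<alpha>: "\<And>i. i < n - 1 \<Longrightarrow> linear_map K N N (\<alpha> i)" and n: "n \<ge> 1" and i: "i < n"
  shows "multilinear_map K (2 * n - 1) N N (nambu_right n br \<alpha> i)"
proof (rule multilinear_mapI)
  fix zs assume zs: "zs \<in> tuples (2 * n - 1) N"
  have len: "length zs = 2 * n - 1" using zs by (simp add: tuples_def)
  define c where "c j = (if j < i then \<alpha> j (zs ! (n - 1 + j))
    else if j = i then br (take (n - 1) zs @ [zs ! (n - 1 + i)])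
    else \<alpha> (j - 1) (zs ! (n - 1 + j)))" for j
  have inner: "take (n - 1) zs @ [zs ! (n - 1 + i)] \<in> tuples n N"
    by (rule nambu_tuples(2)[OF zs n i])
  have closed: "c j \<in> carrier N" if "j < n" for j
  proof -
    note j = that
    have mem: "zs ! (n - 1 + j) \<in> carrier N" using j by (intro tuples_nth[OF zs]) simp
    \<comment> \<open>The twisting maps are linear only for indices below \<open>n - 1\<close>.
      Before the bracket \<open>j < i < n\<close> ensures this bound, after it the shift to
      \<open>j - 1\<close> does.\<close>
    consider "j < i" "j < n - 1" | "j = i" | "\<not> j < i" "j \<noteq> i" "j - 1 < n - 1"
      using i j by linarith
    then show ?thesis
      by cases (simp_all only: c_def if_True if_False refl linear_mapD(3)[OF \<alpha>] mem
          multilinear_map_closed[OF br inner] less_irrefl)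
  qed
  show "nambu_right n br \<alpha> i zs \<in> carrier N"
    unfolding nambu_right_def c_def[symmetric]
    by (rule multilinear_map_closed[OF br]) (simp add: tuples_map_upt closed)
  fix p assume p: "p < 2 * n - 1"
  define g where "g v j = (if j < i then \<alpha> j (zs[p := v] ! (n - 1 + j))
    else if j = i then br (take (n - 1) (zs[p := v]) @ [zs[p := v] ! (n - 1 + i)])
    else \<alpha> (j - 1) (zs[p := v] ! (n - 1 + j)))" for v j
  \<comment> \<open>The outer slot affected by argument \<open>p\<close>: the first
    \<open>n - 1\<close> arguments all occur in the inner bracket at \<open>i\<close>, the others
    are spread over the slots in order.\<close>
  define j where "j = (if p < n - 1 then i else p - (n - 1))"
  have "linear_map K N N (\<lambda>v. br (map (g v) [0..<n]))"
  proof (rule linear_map_slot_compose[OF br N, where c = c and j = j])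
    show "j < n" using p i by (auto simp: j_def)
    show "linear_map K N N (\<lambda>v. g v j)"
    proof (cases "j = i")
      case True
      \<comment> \<open>Inside the inner bracket the first \<open>n - 1\<close> arguments keep their
        index, and the one remaining argument stands last.\<close>
      let ?q = "if p < n - 1 then p else n - 1"
      have "g v i = br ((take (n - 1) zs @ [zs ! (n - 1 + i)])[?q := v])" for v
      proof (cases "p < n - 1")
        case p': True
        then show ?thesis
          using len by (simp add: g_def take_update_swap list_update_append)
      next
        case False
        then have "p = n - 1 + i" using True by (auto simp: j_def)
        then show ?thesis using len p by (simp add: g_def take_update_cancel list_update_append)
      qed
      moreover have "?q < n" using n by auto
      ultimately show ?thesis
        using multilinear_map_slot[OF br N N inner, of ?q] by (simp only: True)
    next
      case False
      then have p': "p = n - 1 + j" by (auto simp: j_def split: if_splits)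
      have "g v j = (if j < i then \<alpha> j v else \<alpha> (j - 1) v)" for v
        using False p len by (simp add: g_def p')
      moreover have "j < i \<Longrightarrow> j < n - 1" "\<not> j < i \<Longrightarrow> j - 1 < n - 1"
        using False i p p' by linarith+
      ultimately show ?thesis using \<alpha> by (cases "j < i") simp_all
    qed
    show "g v k = c k" if "k < n" "k \<noteq> j" for k v
    proof -
      have p: "p \<noteq> n - 1 + k" "k = i \<Longrightarrow> n - 1 \<le> p"
        using that by (auto simp: j_def split: if_splits)
      then have "zs[p := v] ! (n - 1 + k) = zs ! (n - 1 + k)" by simp
      with p show ?thesis
        by (cases "k = i") (simp_all only: g_def c_def less_irrefl if_False if_True refl take_update_cancel)
    qed
  qed (rule closed)
  then show "linear_map K N N (\<lambda>v. nambu_right n br \<alpha> i (zs[p := v]))"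
    by (simp only: nambu_right_def g_def[abs_def])
qed

lemma linear_map_finsum_image:
  assumes f: "linear_map K V W f" and "finite I" and "\<And>i. i \<in> I \<Longrightarrow> g i \<in> carrier V"
  shows "f (\<Oplus>\<^bsub>V\<^esub>i\<in>I. g i) = (\<Oplus>\<^bsub>W\<^esub>i\<in>I. f (g i))"
proof -
  note f' = linear_mapD[OF f]
  interpret V: vectorspace K V by (rule f')
  interpret W: vectorspace K W by (rule f')
  show ?thesis
    using assms(2,3)
  proof (induction I)
    case empty
    then show ?case by (simp add: linear_map_zero[OF f])
  next
    case (insert i I)
    have "g \<in> I \<rightarrow> carrier V" "(\<lambda>j. f (g j)) \<in> I \<rightarrow> carrier W"
      using insert.prems f'(3) by auto
    with insert show ?case by (simp add: f' V.M.finsum_closed)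
  qed
qed

section \<open>The Hom-Nambu identity at pure tensors and its extension\<close>

context tensor_factors
begin

context
  fixes n :: nat
    and \<mu> :: "'a list \<Rightarrow> 'a" and \<eta> :: "nat \<Rightarrow> 'a \<Rightarrow> 'a"
    and br\<^sub>W :: "'b list \<Rightarrow> 'b" and \<alpha> :: "nat \<Rightarrow> 'b \<Rightarrow> 'b"
    and br \<zeta>
  assumes n: "n \<ge> 2"
    and \<mu>: "multilinear_map K n V V \<mu>" and br\<^sub>W: "multilinear_map K n W W br\<^sub>W"
    and \<eta>: "\<And>i. i < n - 1 \<Longrightarrow> linear_map K V V (\<eta> i)"
    and \<alpha>: "\<And>i. i < n - 1 \<Longrightarrow> linear_map K W W (\<alpha> i)"
    and br: "is_tensor_operation K n V W \<mu> br\<^sub>W br"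
    and \<zeta>: "\<And>i. i < n - 1 \<Longrightarrow> is_tensor_map K V W (\<eta> i) (\<alpha> i) (\<zeta> i)"
begin

text \<open>Adapts the prescribed values of \<open>br\<close> to the shape of
  \<open>nambu_left\<close> and \<open>nambu_right\<close>, whose arguments are maps over
  \<open>[0..<n]\<close>.\<close>

lemma tensor_operation_upt:
  assumes "\<And>j. j < n \<Longrightarrow> a j \<in> carrier V" "\<And>j. j < n \<Longrightarrow> x j \<in> carrier W"
    and "\<And>j. j < n \<Longrightarrow> t j = pt (a j) (x j)"
  shows "br (map t [0..<n]) = pt (\<mu> (map a [0..<n])) (br\<^sub>W (map x [0..<n]))"
proof -
  have "map t [0..<n] = map2 pt (map a [0..<n]) (map x [0..<n])"
    using assms(3) by (intro nth_equalityI) auto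
  then show ?thesis
    using br assms(1,2) by (simp add: is_tensor_operation_def tuples_map_upt)
qed

lemma nambu_left_pure:
  assumes cs: "cs \<in> tuples (2 * n - 1) V" and us: "us \<in> tuples (2 * n - 1) W"
  shows "nambu_left n br \<zeta> (map2 pt cs us) = pt (nambu_left n \<mu> \<eta> cs) (nambu_left n br\<^sub>W \<alpha> us)"
  unfolding nambu_left_def
proof (rule tensor_operation_upt)
  have n1: "n \<ge> 1" using n by simp
  have nth: "map2 pt cs us ! k = pt (cs ! k) (us ! k)" if "k < 2 * n - 1" for k
    using that cs us by (simp add: tuples_def)
  have drop: "br (drop (n - 1) (map2 pt cs us)) = pt (\<mu> (drop (n - 1) cs)) (br\<^sub>W (drop (n - 1) us))"
    using br nambu_tuples(1)[OF cs n1] nambu_tuples(1)[OF us n1]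
    by (simp add: is_tensor_operation_def drop_map drop_zip)
  fix j assume "j < n"
  show "(if j < n - 1 then \<eta> j (cs ! j) else \<mu> (drop (n - 1) cs)) \<in> carrier V"
    using linear_mapD(3)[OF \<eta>] tuples_nth[OF cs]
      multilinear_map_closed[OF \<mu> nambu_tuples(1)[OF cs n1]] by (simp del: One_nat_def)
  show "(if j < n - 1 then \<alpha> j (us ! j) else br\<^sub>W (drop (n - 1) us)) \<in> carrier W"
    using linear_mapD(3)[OF \<alpha>] tuples_nth[OF us]
      multilinear_map_closed[OF br\<^sub>W nambu_tuples(1)[OF us n1]] by (simp del: One_nat_def)
  show "(if j < n - 1 then \<zeta> j (map2 pt cs us ! j) else br (drop (n - 1) (map2 pt cs us))) =
      pt (if j < n - 1 then \<eta> j (cs ! j) else \<mu> (drop (n - 1) cs))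
         (if j < n - 1 then \<alpha> j (us ! j) else br\<^sub>W (drop (n - 1) us))"
    using \<zeta>[of j] tuples_nth[OF cs] tuples_nth[OF us]
    by (simp add: nth drop is_tensor_map_def del: One_nat_def)
qed

lemma nambu_right_pure:
  assumes cs: "cs \<in> tuples (2 * n - 1) V" and us: "us \<in> tuples (2 * n - 1) W" and i: "i < n"
  shows "nambu_right n br \<zeta> i (map2 pt cs us) = pt (nambu_right n \<mu> \<eta> i cs) (nambu_right n br\<^sub>W \<alpha> i us)"
  unfolding nambu_right_def
proof (rule tensor_operation_upt)
  have n1: "n \<ge> 1" using n by simp
  have nth: "map2 pt cs us ! k = pt (cs ! k) (us ! k)" if "k < 2 * n - 1" for k
    using that cs us by (simp add: tuples_def)
  have len: "length cs = 2 * n - 1" "length us = 2 * n - 1"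
    using cs us by (auto simp: tuples_def)
  have inner: "br (take (n - 1) (map2 pt cs us) @ [map2 pt cs us ! (n - 1 + i)]) =
      pt (\<mu> (take (n - 1) cs @ [cs ! (n - 1 + i)])) (br\<^sub>W (take (n - 1) us @ [us ! (n - 1 + i)]))"
  proof -
    have "take (n - 1) (map2 pt cs us) @ [map2 pt cs us ! (n - 1 + i)] =
        map2 pt (take (n - 1) cs @ [cs ! (n - 1 + i)]) (take (n - 1) us @ [us ! (n - 1 + i)])"
      using nth[of "n - 1 + i"] i len by (simp add: take_map take_zip)
    then show ?thesis
      using br nambu_tuples(2)[OF cs n1 i] nambu_tuples(2)[OF us n1 i]
      by (simp add: is_tensor_operation_def)
  qed
  fix j assume j: "j < n"
  have mem: "cs ! (n - 1 + j) \<in> carrier V" "us ! (n - 1 + j) \<in> carrier W"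
    using j by (auto intro: tuples_nth[OF cs] tuples_nth[OF us])
  have nthj: "map2 pt cs us ! (n - 1 + j) = pt (cs ! (n - 1 + j)) (us ! (n - 1 + j))"
    using j by (intro nth) simp
  note \<zeta>' = \<zeta>[unfolded is_tensor_map_def, THEN conjunct2, rule_format, OF _ mem]
  consider "j < i" "j < n - 1" | "j = i" | "\<not> j < i" "j \<noteq> i" "j - 1 < n - 1"
    using i j by linarith
  note cases = this
  from cases show "(if j < i then \<eta> j (cs ! (n - 1 + j))
      else if j = i then \<mu> (take (n - 1) cs @ [cs ! (n - 1 + i)])
      else \<eta> (j - 1) (cs ! (n - 1 + j))) \<in> carrier V"
    by cases (simp_all only: if_True if_False refl less_irrefl linear_mapD(3)[OF \<eta>] mem(1)
        multilinear_map_closed[OF \<mu> nambu_tuples(2)[OF cs n1 i]])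
  from cases show "(if j < i then \<alpha> j (us ! (n - 1 + j))
      else if j = i then br\<^sub>W (take (n - 1) us @ [us ! (n - 1 + i)])
      else \<alpha> (j - 1) (us ! (n - 1 + j))) \<in> carrier W"
    by cases (simp_all only: if_True if_False refl less_irrefl linear_mapD(3)[OF \<alpha>] mem(2)
        multilinear_map_closed[OF br\<^sub>W nambu_tuples(2)[OF us n1 i]])
  from cases show "(if j < i then \<zeta> j (map2 pt cs us ! (n - 1 + j))
      else if j = i then br (take (n - 1) (map2 pt cs us) @ [map2 pt cs us ! (n - 1 + i)])
      else \<zeta> (j - 1) (map2 pt cs us ! (n - 1 + j))) =
    pt (if j < i then \<eta> j (cs ! (n - 1 + j))
        else if j = i then \<mu> (take (n - 1) cs @ [cs ! (n - 1 + i)])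
        else \<eta> (j - 1) (cs ! (n - 1 + j)))
       (if j < i then \<alpha> j (us ! (n - 1 + j))
        else if j = i then br\<^sub>W (take (n - 1) us @ [us ! (n - 1 + i)])
        else \<alpha> (j - 1) (us ! (n - 1 + j)))"
    by cases (simp_all only: if_True if_False refl less_irrefl inner nthj \<zeta>')
qed

lemma tensor_hom_nambu_algebra:
  assumes A: "symmetric_totally_hom_assoc_algebra K n V \<mu> \<eta>"
    and N: "hom_nambu_algebra K n W br\<^sub>W \<alpha>"
  shows "hom_nambu_algebra K n T br \<zeta>"
proof -
  have n1: "n \<ge> 1" using n by simp
  note T = tensor_vectorspace
  have brT: "multilinear_map K n T T br" using br by (simp add: is_tensor_operation_def)
  have \<zeta>T: "linear_map K T T (\<zeta> i)" if "i < n - 1" for i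
    using \<zeta>[OF that] by (simp add: is_tensor_map_def)
  note left = nambu_left_multilinear[OF T brT \<zeta>T n1]
  note right = nambu_right_multilinear[OF T brT \<zeta>T n1]
  have sum: "multilinear_map K (2 * n - 1) T T (\<lambda>zs. \<Oplus>\<^bsub>T\<^esub>i\<in>{..<n}. nambu_right n br \<zeta> i zs)"
  proof (rule multilinear_mapI)
    fix zs assume zs: "zs \<in> tuples (2 * n - 1) T"
    show "(\<Oplus>\<^bsub>T\<^esub>i\<in>{..<n}. nambu_right n br \<zeta> i zs) \<in> carrier T"
      using multilinear_map_closed[OF right zs] by (intro T.M.finsum_closed) auto
    show "linear_map K T T (\<lambda>v. \<Oplus>\<^bsub>T\<^esub>i\<in>{..<n}. nambu_right n br \<zeta> i (zs[p := v]))"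
      if "p < 2 * n - 1" for p
      using multilinear_map_slot[OF right T T zs that] by (intro linear_map_finsum T) auto
  qed
  have "nambu_left n br \<zeta> zs = (\<Oplus>\<^bsub>T\<^esub>i\<in>{..<n}. nambu_right n br \<zeta> i zs)"
    if "zs \<in> tuples (2 * n - 1) T" for zs
  proof (rule tensor_multilinear_eqI[OF left sum that])
    fix cs us assume cs: "cs \<in> tuples (2 * n - 1) V" and us: "us \<in> tuples (2 * n - 1) W"
    let ?P = "nambu_left n \<mu> \<eta> cs"
    have P: "?P \<in> carrier V"
      by (rule multilinear_map_closed[OF nambu_left_multilinear[OF V \<mu> \<eta> n1] cs])
    have Q: "nambu_right n br\<^sub>W \<alpha> i us \<in> carrier W" if "i < n" for i
      by (rule multilinear_map_closed[OF nambu_right_multilinear[OF W br\<^sub>W \<alpha> n1 that] us])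
    have "nambu_left n br \<zeta> (map2 pt cs us) = pt ?P (\<Oplus>\<^bsub>W\<^esub>i\<in>{..<n}. nambu_right n br\<^sub>W \<alpha> i us)"
      using N us by (simp add: nambu_left_pure[OF cs us] hom_nambu_algebra_iff[OF n1])
    \<comment> \<open>With the first factor fixed, \<open>pt\<close> is linear in the second, so the
      sum leaves the tensor.\<close>
    also have "\<dots> = (\<Oplus>\<^bsub>T\<^esub>i\<in>{..<n}. pt ?P (nambu_right n br\<^sub>W \<alpha> i us))"
      using bilinear_mapD(2)[OF pure_tensor_bilinear P] Q
      by (intro linear_map_finsum_image) auto
    \<comment> \<open>The common first factor is now replaced, summand by summand, by the one
      belonging to that summand.\<close>
    also have "\<dots> = (\<Oplus>\<^bsub>T\<^esub>i\<in>{..<n}. nambu_right n br \<zeta> i (map2 pt cs us))"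
      using P Q symmetric_hom_assoc_nambu[OF A n _ cs]
      by (intro T.M.finsum_cong') (auto simp: nambu_right_pure[OF cs us] intro!: pure_tensor_closed)
    finally show "nambu_left n br \<zeta> (map2 pt cs us) =
        (\<Oplus>\<^bsub>T\<^esub>i\<in>{..<n}. nambu_right n br \<zeta> i (map2 pt cs us))" .
  qed
  then show ?thesis by (simp add: hom_nambu_algebra_iff[OF n1] T brT \<zeta>T)
qed

end

end

section \<open>The tensor form\<close>

text \<open>A list instead of a set of pairs: repetitions are allowed, and the length is available
  as an induction measure.\<close>

definition pair_sum ::
  "('k, 'z, 'r) module_scheme \<Rightarrow> ('a \<Rightarrow> 'b \<Rightarrow> 'z) \<Rightarrow> ('a \<times> 'b) list \<Rightarrow> 'z" where
  "pair_sum Z \<phi> ps = foldr (\<lambda>(a, x) z. \<phi> a x \<oplus>\<^bsub>Z\<^esub> z) ps \<zero>\<^bsub>Z\<^esub>"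

lemma pair_sum_simps [simp]:
  "pair_sum Z \<phi> [] = \<zero>\<^bsub>Z\<^esub>"
  "pair_sum Z \<phi> ((a, x) # ps) = \<phi> a x \<oplus>\<^bsub>Z\<^esub> pair_sum Z \<phi> ps"
  by (simp_all add: pair_sum_def)

lemma pair_sum_closed:
  assumes "vectorspace K Z" and "\<And>a x. (a, x) \<in> set ps \<Longrightarrow> \<phi> a x \<in> carrier Z"
  shows "pair_sum Z \<phi> ps \<in> carrier Z"
proof -
  interpret Z: vectorspace K Z by fact
  show ?thesis using assms(2) by (induction ps) auto
qed

lemma linear_map_pair_sum:
  assumes h: "linear_map K Z Z' h" and "\<And>a x. (a, x) \<in> set ps \<Longrightarrow> \<phi> a x \<in> carrier Z"
  shows "h (pair_sum Z \<phi> ps) = pair_sum Z' (\<lambda>a x. h (\<phi> a x)) ps"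
  using assms(2)
proof (induction ps)
  case Nil
  then show ?case by (simp add: linear_map_zero[OF h])
next
  case (Cons p ps)
  then have "pair_sum Z \<phi> ps \<in> carrier Z"
    by (intro pair_sum_closed[OF linear_mapD(1)[OF h]]) auto
  with Cons show ?case by (cases p) (simp add: linear_mapD(4)[OF h])
qed

lemma pair_sum_cong:
  "(\<And>a x. (a, x) \<in> set ps \<Longrightarrow> \<phi> a x = \<psi> a x) \<Longrightarrow> pair_sum Z \<phi> ps = pair_sum Z \<psi> ps"
  by (induction ps) auto

lemma pair_sum_append:
  assumes "vectorspace K Z" and "\<And>a x. (a, x) \<in> set (ps @ qs) \<Longrightarrow> \<phi> a x \<in> carrier Z"
  shows "pair_sum Z \<phi> (ps @ qs) = pair_sum Z \<phi> ps \<oplus>\<^bsub>Z\<^esub> pair_sum Z \<phi> qs"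
proof -
  interpret Z: vectorspace K Z by fact
  have qs: "pair_sum Z \<phi> qs \<in> carrier Z"
    using assms by (intro pair_sum_closed[OF assms(1)]) auto
  show ?thesis using assms(2)
  proof (induction ps)
    case Nil
    show ?case using qs by simp
  next
    case (Cons p ps)
    have "pair_sum Z \<phi> ps \<in> carrier Z"
      using Cons.prems by (intro pair_sum_closed[OF assms(1)]) auto
    with Cons qs show ?case by (cases p) (simp add: Z.M.a_assoc)
  qed
qed

section \<open>Tensors as finite sums of pure tensors\<close>

context tensor_factors
begin

lemma tensor_pair_sum_closed: "set ps \<subseteq> S \<Longrightarrow> pair_sum T pt ps \<in> carrier T"
  by (rule pair_sum_closed[OF T.vectorspace_axioms]) (auto intro: pure_tensor_closed)

lemma tensor_pair_sum_exists:
  assumes "t \<in> carrier T"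
  shows "\<exists>ps. set ps \<subseteq> S \<and> t = pair_sum T pt ps"
  using assms
proof (induction t rule: tensor_induct)
  case (pure v w)
  then show ?case
    by (intro exI[of _ "[(v, w)]"]) (simp add: pure_tensor_closed)
next
  case (add t u)
  then obtain ps qs where "set ps \<subseteq> S" "t = pair_sum T pt ps" "set qs \<subseteq> S" "u = pair_sum T pt qs"
    by blast
  moreover from this have "pair_sum T pt (ps @ qs) = t \<oplus>\<^bsub>T\<^esub> u"
    using pair_sum_append[OF T.vectorspace_axioms, of ps qs pt]
    by (auto intro: pure_tensor_closed)
  ultimately show ?case by (intro exI[of _ "ps @ qs"]) simp
next
  case (smult c t)
  then obtain ps where ps: "set ps \<subseteq> S" "t = pair_sum T pt ps" by blast
  \<comment> \<open>\<open>pair_sum\<close> carries no coefficients, so the scalar is absorbed into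
    the first factors.\<close>
  have "c \<odot>\<^bsub>T\<^esub> pair_sum T pt ps = pair_sum T pt (map (\<lambda>(v, w). (c \<odot>\<^bsub>V\<^esub> v, w)) ps)"
    using ps(1)
  proof (induction ps)
    case Nil
    show ?case using smult(1) by simp
  next
    case (Cons p ps)
    then show ?case
      using smult(1) linear_mapD(5)[OF bilinear_mapD(1)[OF pure_tensor_bilinear]]
      by (cases p) (simp add: T.smult_r_distr tensor_pair_sum_closed pure_tensor_closed)
  qed
  moreover have "set (map (\<lambda>(v, w). (c \<odot>\<^bsub>V\<^esub> v, w)) ps) \<subseteq> S"
    using ps(1) smult(1) by auto
  ultimately show ?case using ps(2) by blast
qed

section \<open>Symmetry, nondegeneracy and invariance of the form\<close>

context
  fixes B B' C
  assumes B: "bilinear_form K V B" and B': "bilinear_form K W B'"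
    and C: "is_tensor_form K V W B B' C"
begin

private abbreviation "Z \<equiv> self_module K"

interpretation Z: vectorspace K Z by (rule self_module_vectorspace[OF V.field_axioms])

private lemmas B_linear = bilinear_mapD[OF iffD1[OF bilinear_form_iff[OF V] B]]
private lemmas B'_linear = bilinear_mapD[OF iffD1[OF bilinear_form_iff[OF W] B']]

lemma tensor_form_linear:
  "u \<in> carrier T \<Longrightarrow> linear_map K T Z (\<lambda>t. C t u)"
  "t \<in> carrier T \<Longrightarrow> linear_map K T Z (C t)"
  using C bilinear_form_iff[OF T.vectorspace_axioms]
  by (auto simp: is_tensor_form_def bilinear_map_def)

lemma tensor_form_pure:
  "a \<in> carrier V \<Longrightarrow> x \<in> carrier W \<Longrightarrow> b \<in> carrier V \<Longrightarrow> y \<in> carrier W \<Longrightarrow>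
    C (pt a x) (pt b y) = B a b \<otimes>\<^bsub>K\<^esub> B' x y"
  using C by (simp add: is_tensor_form_def)

lemma tensor_form_symmetric:
  assumes "symmetric_form V B" "symmetric_form W B'"
  shows "symmetric_form T C"
  unfolding symmetric_form_def
proof (intro ballI)
  fix t u assume t: "t \<in> carrier T" and u: "u \<in> carrier T"
  show "C t u = C u t"
  proof (rule tensor_linear_eqI[OF tensor_form_linear(1)[OF u] tensor_form_linear(2)[OF u] t])
    fix a x assume ax: "a \<in> carrier V" "x \<in> carrier W"
    note p = pure_tensor_closed[OF ax]
    show "C (pt a x) u = C u (pt a x)"
    proof (rule tensor_linear_eqI[OF tensor_form_linear(2)[OF p] tensor_form_linear(1)[OF p] u])
      show "C (pt a x) (pt b y) = C (pt b y) (pt a x)" if "b \<in> carrier V" "y \<in> carrier W" for b y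
        using that ax assms by (simp add: tensor_form_pure symmetric_form_def)
    qed
  qed
qed

text \<open>Pairing the contraction with \<open>y\<close> under \<open>B'\<close> is pairing the tensor with \<open>b \<otimes> y\<close> under \<open>C\<close>.\<close>

lemma tensor_form_contract:
  assumes nd: "nondegenerate_form K W B'" and b: "b \<in> carrier V" and ps: "set ps \<subseteq> S"
    and rad: "\<And>u. u \<in> carrier T \<Longrightarrow> C (pair_sum T pt ps) u = \<zero>\<^bsub>K\<^esub>"
  shows "pair_sum W (\<lambda>a x. B a b \<odot>\<^bsub>W\<^esub> x) ps = \<zero>\<^bsub>W\<^esub>"
proof -
  let ?c = "pair_sum W (\<lambda>a x. B a b \<odot>\<^bsub>W\<^esub> x) ps"
  have mem: "a \<in> carrier V \<and> x \<in> carrier W" if "(a, x) \<in> set ps" for a x using ps that by auto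
  have Bb: "B a b \<in> carrier K" if "a \<in> carrier V" for a using B_linear(3)[OF that b] by simp
  have "B' ?c y = \<zero>\<^bsub>K\<^esub>" if y: "y \<in> carrier W" for y
  proof -
    note p = pure_tensor_closed[OF b y]
    have "B' ?c y = pair_sum Z (\<lambda>a x. B' (B a b \<odot>\<^bsub>W\<^esub> x) y) ps"
      using mem Bb by (intro linear_map_pair_sum[OF B'_linear(1)[OF y]]) auto
    also have "\<dots> = pair_sum Z (\<lambda>a x. C (pt a x) (pt b y)) ps"
    proof (rule pair_sum_cong)
      fix a x assume "(a, x) \<in> set ps"
      with mem have ax: "a \<in> carrier V" "x \<in> carrier W" by auto
      show "B' (B a b \<odot>\<^bsub>W\<^esub> x) y = C (pt a x) (pt b y)"
        using linear_mapD(5)[OF B'_linear(1)[OF y] Bb[OF ax(1)] ax(2)]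
        by (simp add: tensor_form_pure ax b y)
    qed
    also have "\<dots> = C (pair_sum T pt ps) (pt b y)"
      using mem by (intro linear_map_pair_sum[OF tensor_form_linear(1)[OF p], symmetric])
        (auto intro: pure_tensor_closed)
    finally show ?thesis using rad[OF p] by simp
  qed
  moreover have "?c \<in> carrier W" using mem Bb by (intro pair_sum_closed[OF W]) auto
  ultimately show ?thesis using nd by (auto simp: nondegenerate_form_def)
qed

text \<open>A summand \<open>a \<otimes> x\<close> can be dropped once \<open>x\<close> is the given combination of the other \<open>x\<^sub>i\<close>.\<close>

lemma tensor_pair_sum_absorb:
  assumes a: "a \<in> carrier V" and b: "b \<in> carrier V" and d: "d \<in> carrier K" and ps: "set ps \<subseteq> S"
  shows "pt a (d \<odot>\<^bsub>W\<^esub> pair_sum W (\<lambda>a x. B a b \<odot>\<^bsub>W\<^esub> x) ps) \<oplus>\<^bsub>T\<^esub> pair_sum T pt ps =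
    pair_sum T pt (map (\<lambda>(a', x). ((d \<otimes>\<^bsub>K\<^esub> B a' b) \<odot>\<^bsub>V\<^esub> a \<oplus>\<^bsub>V\<^esub> a', x)) ps)"
  using ps
proof (induction ps)
  case Nil
  show ?case using linear_map_zero[OF bilinear_mapD(2)[OF pure_tensor_bilinear a]] d by simp
next
  case (Cons p ps)
  obtain a' x where p: "p = (a', x)" by (cases p)
  have mem: "a' \<in> carrier V" "x \<in> carrier W" "set ps \<subseteq> S" using Cons.prems by (auto simp: p)
  note pt1 = linear_mapD[OF bilinear_mapD(1)[OF pure_tensor_bilinear]]
    and pt2 = linear_mapD[OF bilinear_mapD(2)[OF pure_tensor_bilinear]]
  have Bb: "B v b \<in> carrier K" if "v \<in> carrier V" for v using B_linear(3)[OF that b] by simp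
  let ?c = "pair_sum W (\<lambda>a x. B a b \<odot>\<^bsub>W\<^esub> x) ps"
  have c: "?c \<in> carrier W" using mem(3) Bb by (intro pair_sum_closed[OF W]) auto
  have t: "pair_sum T pt ps \<in> carrier T" by (rule tensor_pair_sum_closed[OF mem(3)])
  \<comment> \<open>This scalar crosses the tensor sign from \<open>x\<close> to \<open>a\<close>,
    after which the term merges with \<open>pt a' x\<close> over the common second factor.\<close>
  let ?e = "d \<otimes>\<^bsub>K\<^esub> B a' b"
  have e: "?e \<in> carrier K" using d Bb[OF mem(1)] by simp
  have "pt a (d \<odot>\<^bsub>W\<^esub> (B a' b \<odot>\<^bsub>W\<^esub> x \<oplus>\<^bsub>W\<^esub> ?c)) = pt (?e \<odot>\<^bsub>V\<^esub> a) x \<oplus>\<^bsub>T\<^esub> pt a (d \<odot>\<^bsub>W\<^esub> ?c)"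
    using a d c mem Bb[OF mem(1)] e
    by (simp add: W.smult_r_distr W.smult_assoc1[symmetric] pt1 pt2)
  moreover have "pt (?e \<odot>\<^bsub>V\<^esub> a \<oplus>\<^bsub>V\<^esub> a') x = pt (?e \<odot>\<^bsub>V\<^esub> a) x \<oplus>\<^bsub>T\<^esub> pt a' x"
    using a mem e by (intro pt1(4)) simp_all
  moreover have "pt (?e \<odot>\<^bsub>V\<^esub> a) x \<in> carrier T" "pt a' x \<in> carrier T" "pt a (d \<odot>\<^bsub>W\<^esub> ?c) \<in> carrier T"
    using a d c mem e by (intro pure_tensor_closed; simp)+
  ultimately show ?case
    using Cons.IH[OF mem(3)] t by (simp add: p T.M.a_ac flip: Cons.IH[OF mem(3)])
qed

lemma tensor_form_nondegenerate:
  assumes ndB: "nondegenerate_form K V B" and ndB': "nondegenerate_form K W B'"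
  shows "nondegenerate_form K T C"
proof -
  have zero: "pair_sum T pt ps = \<zero>\<^bsub>T\<^esub>"
    if "set ps \<subseteq> S" "\<And>u. u \<in> carrier T \<Longrightarrow> C (pair_sum T pt ps) u = \<zero>\<^bsub>K\<^esub>" for ps
    using that
  proof (induction "length ps" arbitrary: ps)
    case 0
    then show ?case by simp
  next
    case (Suc k)
    obtain a x qs where ps: "ps = (a, x) # qs" and k: "length qs = k"
      using Suc.hyps(2) by (cases ps) auto
    have mem: "a \<in> carrier V" "x \<in> carrier W" "set qs \<subseteq> S" using Suc.prems(1) by (auto simp: ps)
    \<comment> \<open>A zero first factor contributes nothing and is dropped; a nonzero one is not
      in the radical of \<open>B\<close>, which provides \<open>b\<close>.\<close>
    have "\<exists>rs. length rs = k \<and> set rs \<subseteq> S \<and> pair_sum T pt ps = pair_sum T pt rs"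
    proof (cases "a = \<zero>\<^bsub>V\<^esub>")
      case True
      have "pt \<zero>\<^bsub>V\<^esub> x = \<zero>\<^bsub>T\<^esub>"
        by (rule linear_map_zero[OF bilinear_mapD(1)[OF pure_tensor_bilinear mem(2)]])
      then have "pair_sum T pt ps = pair_sum T pt qs"
        using tensor_pair_sum_closed[OF mem(3)] by (simp add: ps True)
      then show ?thesis using k mem(3) by blast
    next
      case False
      then obtain b where b: "b \<in> carrier V" and ab: "B a b \<noteq> \<zero>\<^bsub>K\<^esub>"
        using ndB mem(1) by (auto simp: nondegenerate_form_def)
      have Bb: "B v b \<in> carrier K" if "v \<in> carrier V" for v using B_linear(3)[OF that b] by simp
      let ?c = "pair_sum W (\<lambda>a x. B a b \<odot>\<^bsub>W\<^esub> x) qs" and ?i = "inv\<^bsub>K\<^esub> B a b"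
      have c: "?c \<in> carrier W" using mem(3) Bb by (intro pair_sum_closed[OF W]) auto
      have i: "?i \<in> carrier K" using Bb[OF mem(1)] ab by (rule V.inverse_exists)
      have "B a b \<odot>\<^bsub>W\<^esub> x \<oplus>\<^bsub>W\<^esub> ?c = \<zero>\<^bsub>W\<^esub>"
        using tensor_form_contract[OF ndB' b Suc.prems] by (simp add: ps)
      then have "B a b \<odot>\<^bsub>W\<^esub> x = \<ominus>\<^bsub>W\<^esub> ?c"
        using c mem(2) Bb[OF mem(1)] by (intro W.M.minus_equality[symmetric]) auto
      then have "x = ?i \<odot>\<^bsub>W\<^esub> (\<ominus>\<^bsub>W\<^esub> ?c)"
        using ab by (intro W.mult_inverse[OF Bb[OF mem(1)] mem(2)])
      \<comment> \<open>Solving the contracted relation for \<open>x\<close> gives the coefficient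
        \<open>d\<close> for \<open>tensor_pair_sum_absorb\<close>: minus the inverse of
        \<open>B a b\<close>.\<close>
      then have x: "x = (\<ominus>\<^bsub>K\<^esub> ?i) \<odot>\<^bsub>W\<^esub> ?c"
        using c i by (simp add: W.smult_l_minus W.smult_r_minus)
      \<comment> \<open>The second factors of \<open>qs\<close> stay; each first factor gains the
        multiple of \<open>a\<close> that comes from expanding \<open>x\<close>.\<close>
      let ?rs = "map (\<lambda>(a', x). ((\<ominus>\<^bsub>K\<^esub> ?i \<otimes>\<^bsub>K\<^esub> B a' b) \<odot>\<^bsub>V\<^esub> a \<oplus>\<^bsub>V\<^esub> a', x)) qs"
      have "pair_sum T pt ps = pair_sum T pt ?rs"
        using tensor_pair_sum_absorb[OF mem(1) b V.R.a_inv_closed[OF i] mem(3)] x by (simp add: ps)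
      moreover have "set ?rs \<subseteq> S"
        using mem Bb i by (fastforce simp: subset_iff)
      ultimately show ?thesis using k by (intro exI[of _ ?rs]) simp
    qed
    \<comment> \<open>The shorter list represents the same tensor, so it inherits the radical
      hypothesis and the induction applies.\<close>
    then show ?case using Suc.hyps(1) Suc.prems(2) by metis
  qed
  show ?thesis
    unfolding nondegenerate_form_def using zero tensor_pair_sum_exists by metis
qed

text \<open>The expression is multilinear in \<open>ts\<close> and linear in \<open>t\<close> and in
  \<open>u\<close>, so each can be taken pure in turn. Then the two scalars from \<open>A\<close>
  coincide, and what remains is a multiple of the relation in \<open>N\<close>.\<close>

lemma tensor_form_hom_invariant:
  fixes n :: nat
  assumes n: "n \<ge> 1"
    and br: "is_tensor_operation K n V W \<mu> br\<^sub>W br"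
    and \<omega>: "is_tensor_map K V W \<beta> \<beta>' \<omega>"
    and \<mu>: "multilinear_map K n V V \<mu>" and br\<^sub>W: "multilinear_map K n W W br\<^sub>W"
    and \<beta>: "linear_map K V V \<beta>" and \<beta>': "linear_map K W W \<beta>'"
    and invB: "\<And>as b c. as \<in> tuples (n - 1) V \<Longrightarrow> b \<in> carrier V \<Longrightarrow> c \<in> carrier V \<Longrightarrow>
      B (\<mu> (as @ [b])) (\<beta> c) = B (\<beta> b) (\<mu> (as @ [c]))"
    and invB': "\<And>xs y z. xs \<in> tuples (n - 1) W \<Longrightarrow> y \<in> carrier W \<Longrightarrow> z \<in> carrier W \<Longrightarrow>
      B' (br\<^sub>W (xs @ [y])) (\<beta>' z) \<oplus>\<^bsub>K\<^esub> B' (\<beta>' y) (br\<^sub>W (xs @ [z])) = \<zero>\<^bsub>K\<^esub>"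
    and ts: "ts \<in> tuples (n - 1) T" and t: "t \<in> carrier T" and u: "u \<in> carrier T"
  shows "C (br (ts @ [t])) (\<omega> u) \<oplus>\<^bsub>K\<^esub> C (\<omega> t) (br (ts @ [u])) = \<zero>\<^bsub>K\<^esub>"
proof -
  note T = T.vectorspace_axioms
  have brT: "multilinear_map K n T T br" using br by (simp add: is_tensor_operation_def)
  have \<omega>T: "linear_map K T T \<omega>" using \<omega> by (simp add: is_tensor_map_def)
  note \<omega>_closed = linear_mapD(3)[OF \<omega>T]
  have snoc_T: "ts @ [t] \<in> tuples n T" if "ts \<in> tuples (n - 1) T" "t \<in> carrier T" for ts t
    using that n by (auto simp: tuples_def)
  have snoc_V: "ts @ [t] \<in> tuples n V" if "ts \<in> tuples (n - 1) V" "t \<in> carrier V" for ts t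
    using that n by (auto simp: tuples_def)
  have snoc_W: "ts @ [t] \<in> tuples n W" if "ts \<in> tuples (n - 1) W" "t \<in> carrier W" for ts t
    using that n by (auto simp: tuples_def)
  have br_closed: "br (ts @ [t]) \<in> carrier T" if "ts \<in> tuples (n - 1) T" "t \<in> carrier T" for ts t
    by (rule multilinear_map_closed[OF brT snoc_T[OF that]])
  have br_init: "linear_map K T T (\<lambda>v. br (ts[i := v] @ [t]))"
    if "ts \<in> tuples (n - 1) T" "t \<in> carrier T" "i < n - 1" for ts t i
    using multilinear_map_slot[OF brT T T snoc_T[OF that(1,2)], of i] that
    by (simp add: list_update_append tuples_def)
  have br_last: "linear_map K T T (\<lambda>v. br (ts @ [v]))" if "ts \<in> tuples (n - 1) T" for ts
    using multilinear_map_slot[OF brT T T snoc_T[OF that T.M.zero_closed], of "n - 1"] that n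
    by (simp add: list_update_append tuples_def)
  \<comment> \<open>Addition is written in \<open>self_module K\<close> so that sums of linear maps
    into it are recognized as linear.\<close>
  let ?f = "\<lambda>ts t u. C (br (ts @ [t])) (\<omega> u) \<oplus>\<^bsub>Z\<^esub> C (\<omega> t) (br (ts @ [u]))"
  have linear_t: "linear_map K T Z (\<lambda>t. ?f ts t u)"
    if "ts \<in> tuples (n - 1) T" "u \<in> carrier T" for ts u
    by (intro linear_map_plus linear_map_compose[OF tensor_form_linear(1) br_last]
        linear_map_compose[OF tensor_form_linear(1) \<omega>T] \<omega>_closed br_closed that)
  have linear_u: "linear_map K T Z (\<lambda>u. ?f ts t u)"
    if "ts \<in> tuples (n - 1) T" "t \<in> carrier T" for ts t
    by (intro linear_map_plus linear_map_compose[OF tensor_form_linear(2) br_last]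
        linear_map_compose[OF tensor_form_linear(2) \<omega>T] \<omega>_closed br_closed that)
  have linear_0: "linear_map K T Z (\<lambda>_. \<zero>\<^bsub>Z\<^esub>)"
    by (rule linear_map_const_zero[OF T Z.vectorspace_axioms])
  have multilinear: "multilinear_map K (n - 1) T Z (\<lambda>ts. ?f ts t u)"
  proof (rule multilinear_mapI)
    show "?f ts t u \<in> carrier Z" if "ts \<in> tuples (n - 1) T" for ts
      by (rule linear_mapD(3)[OF linear_t[OF that u] t])
    show "linear_map K T Z (\<lambda>v. ?f (ts[i := v]) t u)"
      if "ts \<in> tuples (n - 1) T" "i < n - 1" for ts i
      by (intro linear_map_plus linear_map_compose[OF tensor_form_linear(1) br_init]
          linear_map_compose[OF tensor_form_linear(2) br_init] \<omega>_closed that t u)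
  qed
  have multilinear_0: "multilinear_map K (n - 1) T Z (\<lambda>_. \<zero>\<^bsub>Z\<^esub>)"
    by (rule multilinear_mapI[OF _ linear_0]) simp
  have "?f ts t u = \<zero>\<^bsub>Z\<^esub>"
  proof (rule tensor_multilinear_eqI[OF multilinear multilinear_0 ts])
    fix as xs assume as: "as \<in> tuples (n - 1) V" and xs: "xs \<in> tuples (n - 1) W"
    let ?ts = "map2 pt as xs"
    have ts: "?ts \<in> tuples (n - 1) T" by (rule map2_pure_tensor_tuples[OF as xs])
    have pure: "br (?ts @ [pt b y]) = pt (\<mu> (as @ [b])) (br\<^sub>W (xs @ [y]))"
      if "b \<in> carrier V" "y \<in> carrier W" for b y
    proof -
      have "?ts @ [pt b y] = map2 pt (as @ [b]) (xs @ [y])"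
        using as xs by (simp add: tuples_def)
      then show ?thesis
        using br snoc_V[OF as that(1)] snoc_W[OF xs that(2)] by (simp add: is_tensor_operation_def)
    qed
    show "?f ?ts t u = \<zero>\<^bsub>Z\<^esub>"
    proof (rule tensor_linear_eqI[OF linear_t[OF ts u] linear_0 t])
      fix b y assume b: "b \<in> carrier V" and y: "y \<in> carrier W"
      note p = pure_tensor_closed[OF b y]
      show "?f ?ts (pt b y) u = \<zero>\<^bsub>Z\<^esub>"
      proof (rule tensor_linear_eqI[OF linear_u[OF ts p] linear_0 u])
        fix c z assume c: "c \<in> carrier V" and z: "z \<in> carrier W"
        have \<mu>_closed: "\<mu> (as @ [v]) \<in> carrier V" if "v \<in> carrier V" for v
          by (rule multilinear_map_closed[OF \<mu> snoc_V[OF as that]])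
        have brW_closed: "br\<^sub>W (xs @ [w]) \<in> carrier W" if "w \<in> carrier W" for w
          by (rule multilinear_map_closed[OF br\<^sub>W snoc_W[OF xs that]])
        note closed = \<mu>_closed brW_closed linear_mapD(3)[OF \<beta>] linear_mapD(3)[OF \<beta>']
        have \<omega>_pure: "\<omega> (pt v w) = pt (\<beta> v) (\<beta>' w)" if "v \<in> carrier V" "w \<in> carrier W" for v w
          using \<omega> that by (simp add: is_tensor_map_def)
        \<comment> \<open>The common scalar: \<open>invB\<close> turns the \<open>A\<close>-factor
          of the first term into that of the second.\<close>
        let ?P = "B (\<beta> b) (\<mu> (as @ [c]))"
        have P: "?P \<in> carrier K" using B_linear(3) closed b c by simp
        have Q: "B' (br\<^sub>W (xs @ [y])) (\<beta>' z) \<in> carrier K" "B' (\<beta>' y) (br\<^sub>W (xs @ [z])) \<in> carrier K"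
          using B'_linear(3) closed y z by simp_all
        have "?f ?ts (pt b y) (pt c z) =
            ?P \<otimes>\<^bsub>K\<^esub> B' (br\<^sub>W (xs @ [y])) (\<beta>' z) \<oplus>\<^bsub>K\<^esub> ?P \<otimes>\<^bsub>K\<^esub> B' (\<beta>' y) (br\<^sub>W (xs @ [z]))"
          by (simp add: pure \<omega>_pure tensor_form_pure closed b c y z invB[OF as b c])
        also have "\<dots> = ?P \<otimes>\<^bsub>K\<^esub> (B' (br\<^sub>W (xs @ [y])) (\<beta>' z) \<oplus>\<^bsub>K\<^esub> B' (\<beta>' y) (br\<^sub>W (xs @ [z])))"
          using P Q by (simp add: V.R.r_distr)
        also have "\<dots> = \<zero>\<^bsub>Z\<^esub>" using P by (simp add: invB'[OF xs y z])
        finally show "?f ?ts (pt b y) (pt c z) = \<zero>\<^bsub>Z\<^esub>" .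
      qed
    qed
  qed
  then show ?thesis by simp
qed

end

end

text \<open>The second half of the conclusion ranges over all families extending the prescribed
  values, and the first half ensures that it is not vacuous. Such a family is fixed only on the
  carrier and for twisting indices below \<open>n - 1\<close>, hence the quantifier over
  families.\<close>

theorem theorem5p5:
  fixes K :: "('k, 'm) ring_scheme"
    and A :: "('k, 'a, 'p) module_scheme"
    and N :: "('k, 'b, 'q) module_scheme"
    and n :: nat
    and \<mu> :: "'a list \<Rightarrow> 'a" and \<eta> :: "nat \<Rightarrow> 'a \<Rightarrow> 'a"
    and B\<^sub>A :: "'a \<Rightarrow> 'a \<Rightarrow> 'k" and \<beta>\<^sub>A :: "'a \<Rightarrow> 'a"
    and br\<^sub>N :: "'b list \<Rightarrow> 'b" and \<alpha> :: "nat \<Rightarrow> 'b \<Rightarrow> 'b"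
    and B\<^sub>N :: "'b \<Rightarrow> 'b \<Rightarrow> 'k" and \<beta>\<^sub>N :: "'b \<Rightarrow> 'b"
  assumes "algebraically_closed K" and "char_zero K" and "n \<ge> 2"
    and "hom_quadratic_symmetric_totally_hom_assoc_algebra K n A \<mu> \<eta> B\<^sub>A \<beta>\<^sub>A"
    and "hom_quadratic_hom_nambu_algebra K n N br\<^sub>N \<alpha> B\<^sub>N \<beta>\<^sub>N"
  shows
    "(\<exists>br \<zeta> B \<omega>.
        is_tensor_operation K n A N \<mu> br\<^sub>N br \<and>
        (\<forall>i < n - 1. is_tensor_map K A N (\<eta> i) (\<alpha> i) (\<zeta> i)) \<and>
        is_tensor_form K A N B\<^sub>A B\<^sub>N B \<and>
        is_tensor_map K A N \<beta>\<^sub>A \<beta>\<^sub>N \<omega>) \<and>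
     (\<forall>br \<zeta> B \<omega>.
        is_tensor_operation K n A N \<mu> br\<^sub>N br \<and>
        (\<forall>i < n - 1. is_tensor_map K A N (\<eta> i) (\<alpha> i) (\<zeta> i)) \<and>
        is_tensor_form K A N B\<^sub>A B\<^sub>N B \<and>
        is_tensor_map K A N \<beta>\<^sub>A \<beta>\<^sub>N \<omega> \<longrightarrow>
        hom_quadratic_hom_nambu_algebra K n (tensor_product K A N) br \<zeta> B \<omega>)"
proof -
  note A = assms(4)[unfolded hom_quadratic_symmetric_totally_hom_assoc_algebra_def]
  note A' = A[THEN conjunct1, unfolded symmetric_totally_hom_assoc_algebra_def]
  note N = assms(5)[unfolded hom_quadratic_hom_nambu_algebra_def]
  note N' = N[THEN conjunct1, unfolded hom_nambu_algebra_def]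
  have V: "vectorspace K A" and W: "vectorspace K N"
    and \<mu>: "multilinear_map K n A A \<mu>" and brN: "multilinear_map K n N N br\<^sub>N"
    and \<eta>: "\<And>i. i < n - 1 \<Longrightarrow> linear_map K A A (\<eta> i)"
    and \<alpha>: "\<And>i. i < n - 1 \<Longrightarrow> linear_map K N N (\<alpha> i)"
    using A' N' by simp_all
  interpret tensor_factors K A N
    using V W by (rule tensor_factors.intro)
  have B: "bilinear_form K A B\<^sub>A" "bilinear_form K N B\<^sub>N"
    and sym: "symmetric_form A B\<^sub>A" "symmetric_form N B\<^sub>N"
    and nd: "nondegenerate_form K A B\<^sub>A" "nondegenerate_form K N B\<^sub>N"
    and \<beta>: "linear_map K A A \<beta>\<^sub>A" "linear_map K N N \<beta>\<^sub>N"
    using A N by simp_all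
  show ?thesis
  proof (intro conjI allI impI)
    obtain br where br: "is_tensor_operation K n A N \<mu> br\<^sub>N br"
      using tensor_operation_exists[OF \<mu> brN] ..
    \<comment> \<open>One map is chosen for each index below \<open>n - 1\<close>; at other indices
      \<zeta> is arbitrary.\<close>
    have "\<exists>\<zeta>. \<forall>i\<in>{..<n - 1}. is_tensor_map K A N (\<eta> i) (\<alpha> i) (\<zeta> i)"
      using tensor_map_exists[OF \<eta> \<alpha>] by (intro bchoice) simp
    then obtain \<zeta> where \<zeta>: "\<forall>i\<in>{..<n - 1}. is_tensor_map K A N (\<eta> i) (\<alpha> i) (\<zeta> i)" ..
    obtain C where C: "is_tensor_form K A N B\<^sub>A B\<^sub>N C"
      using tensor_form_exists[OF B] ..
    obtain \<omega> where \<omega>: "is_tensor_map K A N \<beta>\<^sub>A \<beta>\<^sub>N \<omega>"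
      using tensor_map_exists[OF \<beta>] ..
    show "\<exists>br \<zeta> B \<omega>. is_tensor_operation K n A N \<mu> br\<^sub>N br \<and>
        (\<forall>i < n - 1. is_tensor_map K A N (\<eta> i) (\<alpha> i) (\<zeta> i)) \<and>
        is_tensor_form K A N B\<^sub>A B\<^sub>N B \<and> is_tensor_map K A N \<beta>\<^sub>A \<beta>\<^sub>N \<omega>"
      using br \<zeta> C \<omega> by (intro exI[of _ br] exI[of _ \<zeta>] exI[of _ C] exI[of _ \<omega>]) simp
  next
    fix br \<zeta> C \<omega>
    assume "is_tensor_operation K n A N \<mu> br\<^sub>N br \<and>
        (\<forall>i < n - 1. is_tensor_map K A N (\<eta> i) (\<alpha> i) (\<zeta> i)) \<and>
        is_tensor_form K A N B\<^sub>A B\<^sub>N C \<and> is_tensor_map K A N \<beta>\<^sub>A \<beta>\<^sub>N \<omega>"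
    then have br: "is_tensor_operation K n A N \<mu> br\<^sub>N br"
      and \<zeta>: "\<And>i. i < n - 1 \<Longrightarrow> is_tensor_map K A N (\<eta> i) (\<alpha> i) (\<zeta> i)"
      and C: "is_tensor_form K A N B\<^sub>A B\<^sub>N C" and \<omega>: "is_tensor_map K A N \<beta>\<^sub>A \<beta>\<^sub>N \<omega>"
      by simp_all
    have n: "n \<ge> 1" using assms(3) by simp
    have "hom_nambu_algebra K n (tensor_product K A N) br \<zeta>"
      by (rule tensor_hom_nambu_algebra[OF assms(3) \<mu> brN \<eta> \<alpha> br \<zeta> A[THEN conjunct1] N[THEN conjunct1]])
    moreover have "symmetric_form (tensor_product K A N) C"
      by (rule tensor_form_symmetric[OF B C sym])
    moreover have "nondegenerate_form K (tensor_product K A N) C"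
      by (rule tensor_form_nondegenerate[OF B C nd])
    moreover have "C (br (ts @ [t])) (\<omega> u) \<oplus>\<^bsub>K\<^esub> C (\<omega> t) (br (ts @ [u])) = \<zero>\<^bsub>K\<^esub>"
      if "ts \<in> tuples (n - 1) (tensor_product K A N)" "t \<in> carrier (tensor_product K A N)"
        "u \<in> carrier (tensor_product K A N)" for ts t u
      by (rule tensor_form_hom_invariant[OF B C n br \<omega> \<mu> brN \<beta> _ _ that]) (use A N in simp_all)
    ultimately show "hom_quadratic_hom_nambu_algebra K n (tensor_product K A N) br \<zeta> C \<omega>"
      using C \<omega> by (simp add: hom_quadratic_hom_nambu_algebra_def is_tensor_form_def is_tensor_map_def)
  qed
qed

end
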